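(* Let $Q=[u_1,\dots,u_n]$, $n\ge 4$, be a spherical polygon in $\mathbb{S}^2$, no three of whose vertices lie on a common great circle. Suppose that $Q$ is balanced (its vertices are not all contained in one closed hemisphere) and that $Q$ has no self-intersections. Then $Q$ has at least four spherical inflections.
   Context: Indices are taken modulo $n$. A spherical polygon $Q=[u_1,\dots,u_n]$ on the unit sphere $\mathbb{S}^2\subset\mathbb{R}^3$ is the closed spherical polygonal line whose edges are the minimal-length great-circle segments joining $u_i$ to $u_{i+1}$, where consecutive vertices are not antipodal. "No three vertices on a common great circle" means $\det(u_i,u_j,u_k)\ne 0$ for all distinct indices $i,j,k$. A closed hemisphere is a set $\{x\in\mathbb{S}^2:\langle x,w\rangle\ge 0\}$ with $w\neq 0$. $Q$ has no self-intersections if its vertices are pairwise distinct, non-adjacent edges are disjoint, and adjacent edges meet only at their common vertex. A spherical inflection of $Q$ is a pair $\{u_i,u_{i+1}\}$ ($i$ modulo $n$) such that $u_{i-1}$ and $u_{i+2}$ are (strictly) on different sides of the plane spanned by $u_i,u_{i+1}$; equivalently, the determinants $[u_{i-1},u_i,u_{i+1}]$ and $[u_i,u_{i+1},u_{i+2}]$ have opposite signs. *)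

theory Defs
  imports "HOL-Analysis.Analysis"
begin

definition det3 :: "real^3 \<Rightarrow> real^3 \<Rightarrow> real^3 \<Rightarrow> real" where
  "det3 a b c = det (vector [a, b, c] :: real^3^3)"

text \<open>The shorter great-circle arc between non-antipodal unit vectors is the part of the sphere
  inside the cone they span; \<open>great_circle_segment_eq_geodesic\<close> below confirms that this is the
  metric segment for the angular distance.\<close>

definition great_circle_segment :: "real^3 \<Rightarrow> real^3 \<Rightarrow> (real^3) set" where
  "great_circle_segment u v =
     {x \<in> sphere 0 1. \<exists>a b. 0 \<le> a \<and> 0 \<le> b \<and> x = a *\<^sub>R u + b *\<^sub>R v}"

text \<open>A polygon \<open>[u\<^sub>1, \<dots>, u\<^sub>n]\<close> is given by a number \<open>n\<close> and a function \<open>u\<close>, of which only the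
  values at \<open>0, \<dots>, n - 1\<close> are relevant; all indices are reduced modulo \<open>n\<close>.\<close>

definition spherical_polygon :: "nat \<Rightarrow> (nat \<Rightarrow> real^3) \<Rightarrow> bool" where
  "spherical_polygon n u \<longleftrightarrow>
     (\<forall>i<n. u i \<in> sphere 0 1) \<and> (\<forall>i<n. u ((i + 1) mod n) \<noteq> - u i)"

definition polygon_edge :: "nat \<Rightarrow> (nat \<Rightarrow> real^3) \<Rightarrow> nat \<Rightarrow> (real^3) set" where
  "polygon_edge n u i = great_circle_segment (u i) (u ((i + 1) mod n))"

definition no_three_on_great_circle :: "nat \<Rightarrow> (nat \<Rightarrow> real^3) \<Rightarrow> bool" where
  "no_three_on_great_circle n u \<longleftrightarrow>
     (\<forall>i<n. \<forall>j<n. \<forall>k<n. i \<noteq> j \<and> j \<noteq> k \<and> i \<noteq> k \<longrightarrow> det3 (u i) (u j) (u k) \<noteq> 0)"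

definition closed_hemisphere :: "(real^3) set \<Rightarrow> bool" where
  "closed_hemisphere H \<longleftrightarrow> (\<exists>w. w \<noteq> 0 \<and> H = {x \<in> sphere 0 1. x \<bullet> w \<ge> 0})"

definition balanced :: "nat \<Rightarrow> (nat \<Rightarrow> real^3) \<Rightarrow> bool" where
  "balanced n u \<longleftrightarrow> \<not> (\<exists>H. closed_hemisphere H \<and> u ` {..<n} \<subseteq> H)"

definition no_self_intersections :: "nat \<Rightarrow> (nat \<Rightarrow> real^3) \<Rightarrow> bool" where
  "no_self_intersections n u \<longleftrightarrow>
     inj_on u {..<n} \<and>
     (\<forall>i<n. \<forall>j<n. i \<noteq> j \<and> j \<noteq> (i + 1) mod n \<and> i \<noteq> (j + 1) mod n \<longrightarrow>
        polygon_edge n u i \<inter> polygon_edge n u j = {}) \<and>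
     (\<forall>i<n. polygon_edge n u i \<inter> polygon_edge n u ((i + 1) mod n) = {u ((i + 1) mod n)})"

text \<open>\<open>p\<close> and \<open>q\<close> lie strictly on different sides of the plane spanned by \<open>a\<close> and \<open>b\<close>. Replacing
  \<open>w\<close> by \<open>- w\<close> shows that the condition is symmetric in \<open>p\<close> and \<open>q\<close>. It fails when \<open>a\<close> and \<open>b\<close>
  are linearly dependent.\<close>

definition plane_separates :: "real^3 \<Rightarrow> real^3 \<Rightarrow> real^3 \<Rightarrow> real^3 \<Rightarrow> bool" where
  "plane_separates a b p q \<longleftrightarrow>
     (\<exists>w. span {a, b} = {x. w \<bullet> x = 0} \<and> w \<bullet> p < 0 \<and> 0 < w \<bullet> q)"

text \<open>The index \<open>i - 1\<close> modulo \<open>n\<close> is written \<open>(i + n - 1) mod n\<close> to avoid truncated subtraction.\<close>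

definition spherical_inflections :: "nat \<Rightarrow> (nat \<Rightarrow> real^3) \<Rightarrow> (real^3) set set" where
  "spherical_inflections n u =
     {{u i, u ((i + 1) mod n)} | i. i < n \<and>
        plane_separates (u i) (u ((i + 1) mod n)) (u ((i + n - 1) mod n)) (u ((i + 2) mod n))}"

lemma great_circle_segment_eq_geodesic:
  assumes u: "u \<in> sphere 0 1" and v: "v \<in> sphere 0 1" and uv: "v \<noteq> - u"
  shows "great_circle_segment u v =
    {x \<in> sphere 0 1. arccos (u \<bullet> x) + arccos (x \<bullet> v) = arccos (u \<bullet> v)}"
proof -
  have nu: "u \<bullet> u = 1" and nv: "v \<bullet> v = 1" using u v by (auto simp: dot_square_norm)
  have bd: "\<bar>x \<bullet> y\<bar> \<le> 1" if "x \<in> sphere 0 1" "y \<in> sphere 0 1" for x y :: "real^3"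
    using Cauchy_Schwarz_ineq2[of x y] that by simp
  have c1: "u \<bullet> v \<noteq> -1"
  proof
    assume "u \<bullet> v = -1"
    then have "(u + v) \<bullet> (u + v) = 0" using nu nv by (simp add: inner_add inner_commute)
    then have "u + v = 0" by simp
    then show False using uv by (simp add: add_eq_0_iff)
  qed
  have c: "-1 < u \<bullet> v" "u \<bullet> v \<le> 1" using bd[OF u v] c1 by auto
  show ?thesis
  proof (intro set_eqI iffI)
    fix x assume "x \<in> great_circle_segment u v"
    then obtain a b where x: "x \<in> sphere 0 1" and ab: "0 \<le> a" "0 \<le> b" and
      xe: "x = a *\<^sub>R u + b *\<^sub>R v" by (auto simp: great_circle_segment_def)
    define c where "c = u \<bullet> v"
    define s where "s = sqrt (1 - c\<^sup>2)"
    have cb: "-1 < c" "c \<le> 1" using \<open>-1 < u \<bullet> v\<close> \<open>u \<bullet> v \<le> 1\<close> by (auto simp: c_def)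
    have s2: "s\<^sup>2 = 1 - c\<^sup>2" using cb by (simp add: s_def abs_square_le_1)
    have s0: "0 \<le> s" using cb by (simp add: s_def abs_square_le_1)
    have ux: "u \<bullet> x = a + b * c" and xv: "x \<bullet> v = a * c + b"
      using nu nv by (auto simp: xe inner_add c_def)
    have "x \<bullet> x = 1" using x by (simp add: dot_square_norm)
    then have q: "a\<^sup>2 + 2 * a * b * c + b\<^sup>2 = 1"
      using nu nv by (simp add: xe inner_add c_def inner_commute power2_eq_square algebra_simps)
    let ?A = "arccos (u \<bullet> x)" and ?B = "arccos (x \<bullet> v)"
    have cA: "cos ?A = a + b * c" and cB: "cos ?B = a * c + b"
      using bd[OF u x] bd[OF x v] ux xv by (auto simp: cos_arccos_abs)
    have "1 - (a + b * c)\<^sup>2 = (b * s)\<^sup>2"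
      unfolding power_mult_distrib s2 using q by (simp add: power2_eq_square algebra_simps)
    then have sA: "sin ?A = b * s"
      using bd[OF u x] ux ab s0 by (simp add: sin_arccos_abs)
    have "1 - (a * c + b)\<^sup>2 = (a * s)\<^sup>2"
      unfolding power_mult_distrib s2 using q by (simp add: power2_eq_square algebra_simps)
    then have sB: "sin ?B = a * s"
      using bd[OF x v] xv ab s0 by (simp add: sin_arccos_abs)
    have "cos (?A + ?B) = (a + b * c) * (a * c + b) - a * b * s\<^sup>2"
      by (simp add: cos_add cA cB sA sB power2_eq_square)
    also have "\<dots> = c * (a\<^sup>2 + 2 * a * b * c + b\<^sup>2)"
      unfolding s2 by (simp add: power2_eq_square algebra_simps)
    finally have cAB: "cos (?A + ?B) = c" using q by simp
    have AB: "0 \<le> ?A" "?A \<le> pi" "0 \<le> ?B" "?B \<le> pi"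
      using bd[OF u x] bd[OF x v] by (auto intro: arccos_lbound arccos_ubound)
    have "cos ?A + cos ?B = (a + b) * (1 + c)" by (simp add: cA cB algebra_simps)
    also have "0 \<le> \<dots>" using ab cb by simp
    finally have "cos (pi - ?B) \<le> cos ?A" by simp
    then have "?A \<le> pi - ?B" using AB by (subst (asm) cos_mono_le_eq) auto
    then have "arccos (cos (?A + ?B)) = ?A + ?B" using AB by (intro arccos_cos) auto
    then show "x \<in> {x \<in> sphere 0 1. arccos (u \<bullet> x) + arccos (x \<bullet> v) = arccos (u \<bullet> v)}"
      using x cAB by (simp add: c_def)
  next
    fix x assume "x \<in> {x \<in> sphere 0 1. arccos (u \<bullet> x) + arccos (x \<bullet> v) = arccos (u \<bullet> v)}"
    then have x: "x \<in> sphere 0 1" and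
      e: "arccos (u \<bullet> x) + arccos (x \<bullet> v) = arccos (u \<bullet> v)" by auto
    have nx: "x \<bullet> x = 1" using x by (simp add: dot_square_norm)
    define A B where "A = arccos (u \<bullet> x)" and "B = arccos (x \<bullet> v)"
    have AB: "0 \<le> A" "A \<le> pi" "0 \<le> B" "B \<le> pi"
      using bd[OF u x] bd[OF x v] by (auto simp: A_def B_def intro: arccos_lbound arccos_ubound)
    have ux: "u \<bullet> x = cos A" and xv: "x \<bullet> v = cos B" and uv': "u \<bullet> v = cos (A + B)"
      using bd[OF u x] bd[OF x v] bd[OF u v] e by (auto simp: A_def B_def cos_arccos_abs)
    have "A + B \<noteq> pi" using c1 uv' by auto
    moreover have "A + B \<le> pi" using e c arccos_ubound[of "u \<bullet> v"] by (simp add: A_def B_def)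
    ultimately have lt: "A + B < pi" by simp
    show "x \<in> great_circle_segment u v"
    proof (cases "A + B = 0")
      case True
      then have "A = 0" using AB by linarith
      then have "u \<bullet> x = 1" using ux by simp
      then have "(u - x) \<bullet> (u - x) = 0" using nu nx by (simp add: inner_diff inner_commute)
      then have "x = 1 *\<^sub>R u + 0 *\<^sub>R v" by simp
      then show ?thesis using x unfolding great_circle_segment_def
        by (intro CollectI conjI exI[of _ 1] exI[of _ 0]) auto
    next
      case False
      define s where "s = sin (A + B)"
      have s: "0 < s" unfolding s_def using False lt AB by (intro sin_gt_zero) auto
      define w where "w = sin B *\<^sub>R u + sin A *\<^sub>R v - s *\<^sub>R x"
      have "w \<bullet> w = (sin B)\<^sup>2 + (sin A)\<^sup>2 + s\<^sup>2 + 2 * sin B * sin A * cos (A + B)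
          - 2 * sin B * s * cos A - 2 * sin A * s * cos B"
        using nu nv nx ux xv uv' unfolding w_def
        by (simp add: inner_add inner_diff inner_commute power2_eq_square algebra_simps)
      also have "\<dots> = 0"
      proof -
        have "(cos A)\<^sup>2 = 1 - (sin A)\<^sup>2" "(cos B)\<^sup>2 = 1 - (sin B)\<^sup>2"
          by (simp_all add: cos_squared_eq)
        then show ?thesis unfolding s_def sin_add cos_add by algebra
      qed
      finally have "w = 0" by simp
      then have "s *\<^sub>R x = sin B *\<^sub>R u + sin A *\<^sub>R v" by (simp add: w_def)
      then have "x = (1 / s) *\<^sub>R (sin B *\<^sub>R u + sin A *\<^sub>R v)" using s
        by (metis divide_inverse_commute less_irrefl mult.right_neutral scaleR_one scaleR_scaleR
            nonzero_divide_eq_eq)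
      then have "x = (sin B / s) *\<^sub>R u + (sin A / s) *\<^sub>R v" by (simp add: scaleR_add_right)
      moreover have "0 \<le> sin B / s" "0 \<le> sin A / s" using s AB by (simp_all add: sin_ge_zero)
      ultimately show ?thesis using x unfolding great_circle_segment_def by blast
    qed
  qed
qed

lemma plane_separates_iff_det3:
  "plane_separates a b p q \<longleftrightarrow> det3 p a b * det3 a b q < 0"
proof -
  define m where "m = cross3 a b"
  have cyc: "det3 p a b = m \<bullet> p" and cyc': "det3 a b q = m \<bullet> q"
    unfolding det3_def m_def by (simp_all add: cross3_simps)
  have orth: "m \<bullet> a = 0" "m \<bullet> b = 0" unfolding m_def by (simp_all add: cross3_simps)
  show ?thesis
  proof
    assume "plane_separates a b p q"
    then obtain w where w: "span {a, b} = {x. w \<bullet> x = 0}" "w \<bullet> p < 0" "0 < w \<bullet> q"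
      unfolding plane_separates_def by blast
    have w0: "w \<noteq> 0" using w by auto
    have m0: "m \<noteq> 0"
    proof
      assume "m = 0"
      then have "collinear {0, a, b}" by (simp add: m_def cross_eq_0)
      then consider "a = 0" | "b = 0" | c where "b = c *\<^sub>R a"
        unfolding collinear_lemma by blast
      then have "\<exists>z. {a, b} \<subseteq> span {z}"
        by cases (metis empty_subsetI insert_subset span_base span_zero singletonI span_mul)+
      then obtain z where "span {a, b} \<subseteq> span {z}" using span_minimal by blast
      then have "dim (span {a, b}) \<le> card {z}" by (intro dim_le_card) auto
      moreover have "dim (span {a, b}) = 2" using w(1) dim_hyperplane[OF w0] by simp
      ultimately show False by simp
    qed
    have "w \<bullet> a = 0" "w \<bullet> b = 0" using w(1) span_base[of _ "{a, b}"] by auto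
    then have "cross3 w m = 0" unfolding m_def by (simp add: Lagrange inner_commute)
    then have "collinear {0, m, w}" by (simp add: cross_eq_0 insert_commute)
    then obtain k where "w = k *\<^sub>R m" using m0 w0 unfolding collinear_lemma by blast
    then have "k * (m \<bullet> p) < 0" "0 < k * (m \<bullet> q)" using w by auto
    then show "det3 p a b * det3 a b q < 0"
      unfolding cyc cyc' by (auto simp: mult_less_0_iff zero_less_mult_iff)
  next
    assume "det3 p a b * det3 a b q < 0"
    then have s: "(m \<bullet> p) * (m \<bullet> q) < 0" unfolding cyc cyc' .
    then have m0: "m \<noteq> 0" by auto
    have sp: "span {a, b} = {x. m \<bullet> x = 0}"
    proof
      show "span {a, b} \<subseteq> {x. m \<bullet> x = 0}"
        using orth by (intro span_minimal subspace_hyperplane) auto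
    next
      show "{x. m \<bullet> x = 0} \<subseteq> span {a, b}"
      proof clarify
        fix x assume x: "m \<bullet> x = 0"
        have "(m \<bullet> m) *\<^sub>R x = (cross3 x b \<bullet> m) *\<^sub>R a + (cross3 a x \<bullet> m) *\<^sub>R b + (m \<bullet> x) *\<^sub>R m"
          unfolding m_def by (simp add: cross3_simps forall_3)
        also have "\<dots> \<in> span {a, b}"
          using x by (simp add: span_add span_mul span_base)
        finally have "(1 / (m \<bullet> m)) *\<^sub>R ((m \<bullet> m) *\<^sub>R x) \<in> span {a, b}"
          by (rule span_mul)
        then show "x \<in> span {a, b}" using m0 by simp
      qed
    qed
    show "plane_separates a b p q"
    proof (cases "m \<bullet> p < 0")
      case True
      then show ?thesis using s sp unfolding plane_separates_def
        by (intro exI[of _ m]) (auto simp: mult_less_0_iff)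
    next
      case False
      then show ?thesis using s sp unfolding plane_separates_def
        by (intro exI[of _ "- m"]) (auto simp: mult_less_0_iff)
    qed
  qed
qed

end

theory Submission
  imports Defs
begin

text \<open>Extend the edges of the polygon to a maximal family of noncrossing arcs between vertices. Since the
  vertices are balanced, this triangulates the sphere into \<open>2 n - 4\<close> empty triangles. The \<open>n\<close> edges
  account for \<open>2 n\<close> sides of these triangles, so at least four of them are ears, formed by three
  consecutive vertices. If \<open>n \<ge> 5\<close>, at most three vertices are indispensable for balance, so some ear
  can be cut off without losing balance. Cutting off an ear keeps the polygon simple and does not
  create new changes of sign in the sequence of turns, whose changes are the inflections. After
  finitely many steps one reaches a balanced quadrilateral, whose four turns alternate.\<close>

subsection \<open>Determinants and open cones\<close>

text \<open>The induction must preserve simplicity and balance and must not create inflections.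
  Emptiness of the ear secures simplicity, since an edge through the new side would have to end in
  the ear or cross an old side. It also controls the turns: at a neighbour of the removed vertex the
  turn can only move towards the turn at that vertex. Balance is the obstacle, because an ear tip
  may be indispensable; there is always one ear more than the vertices that can be. In a balanced
  quadrilateral every vertex is indispensable, which is why the induction stops there. Balance also
  makes the regions triangles: every arc has vertices on both of its sides. The bound on the faces
  is counted along the meridians of a generic axis, which takes only angular sectors at the vertices
  and no global topology. All notions are invariant under positive scaling of the vertices, so arcs
  become plane cones, triangles become solid cones, and sides are read off determinants.\<close>

lemma det3_expand:
  "det3 a b c = a$1*b$2*c$3 + a$2*b$3*c$1 + a$3*b$1*c$2 - a$1*b$3*c$2 - a$2*b$1*c$3 - a$3*b$2*c$1"
  by (simp add: det3_def det_3)

lemma det3_linear [simp]: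
  "det3 (x + y) b c = det3 x b c + det3 y b c"
  "det3 a (x + y) c = det3 a x c + det3 a y c"
  "det3 a b (x + y) = det3 a b x + det3 a b y"
  "det3 (x - y) b c = det3 x b c - det3 y b c"
  "det3 a (x - y) c = det3 a x c - det3 a y c"
  "det3 a b (x - y) = det3 a b x - det3 a b y"
  "det3 (k *\<^sub>R x) b c = k * det3 x b c"
  "det3 a (k *\<^sub>R x) c = k * det3 a x c"
  "det3 a b (k *\<^sub>R x) = k * det3 a b x"
  "det3 (- x) b c = - det3 x b c"
  "det3 a (- x) c = - det3 a x c"
  "det3 a b (- x) = - det3 a b x"
  "det3 0 b c = 0" "det3 a 0 c = 0" "det3 a b 0 = 0"
  by (simp_all add: det3_expand algebra_simps)

lemma det3_same [simp]: "det3 a a b = 0" "det3 a b a = 0" "det3 b a a = 0"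
  by (simp_all add: det3_expand algebra_simps)

lemma det3_swap12: "det3 b a c = - det3 a b c"
  and det3_swap23: "det3 a c b = - det3 a b c"
  and det3_rotate: "det3 b c a = det3 a b c"
  by (simp_all add: det3_expand algebra_simps)

lemma cramer3:
  "det3 a b c *\<^sub>R x = det3 x b c *\<^sub>R a + det3 a x c *\<^sub>R b + det3 a b x *\<^sub>R c"
  by (simp add: vec_eq_iff forall_3 det3_expand algebra_simps)

lemma det3_coords:
  assumes "det3 a b c \<noteq> 0"
  obtains \<alpha> \<beta> \<gamma> where "x = \<alpha> *\<^sub>R a + \<beta> *\<^sub>R b + \<gamma> *\<^sub>R c"
proof -
  let ?D = "det3 a b c"
  have "x = (1 / ?D) *\<^sub>R (?D *\<^sub>R x)" using assms by simp
  also have "\<dots> = (det3 x b c / ?D) *\<^sub>R a + (det3 a x c / ?D) *\<^sub>R b + (det3 a b x / ?D) *\<^sub>R c"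
    by (subst cramer3) (simp add: scaleR_add_right)
  finally show thesis by (rule that)
qed

lemma det3_inner: "det3 a b x = x \<bullet> cross3 a b"
  by (simp add: det3_expand cross3_simps)

text \<open>The cone over an arc without its ends. Working with rays removes all normalisation to
  unit length, and leaving out the ends keeps arcs with a common vertex from counting as
  crossing.\<close>

definition open_cone2 :: "real^3 \<Rightarrow> real^3 \<Rightarrow> (real^3) set" where
  "open_cone2 a b = {\<alpha> *\<^sub>R a + \<beta> *\<^sub>R b | \<alpha> \<beta>. 0 < \<alpha> \<and> 0 < \<beta>}"

definition open_cone3 :: "real^3 \<Rightarrow> real^3 \<Rightarrow> real^3 \<Rightarrow> (real^3) set" where
  "open_cone3 a b c = {\<alpha> *\<^sub>R a + \<beta> *\<^sub>R b + \<gamma> *\<^sub>R c | \<alpha> \<beta> \<gamma>. 0 < \<alpha> \<and> 0 < \<beta> \<and> 0 < \<gamma>}"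

lemma open_cone2I: "0 < \<alpha> \<Longrightarrow> 0 < \<beta> \<Longrightarrow> \<alpha> *\<^sub>R a + \<beta> *\<^sub>R b \<in> open_cone2 a b"
  by (auto simp: open_cone2_def)

lemma open_cone3I:
  "0 < \<alpha> \<Longrightarrow> 0 < \<beta> \<Longrightarrow> 0 < \<gamma> \<Longrightarrow> \<alpha> *\<^sub>R a + \<beta> *\<^sub>R b + \<gamma> *\<^sub>R c \<in> open_cone3 a b c"
  by (auto simp: open_cone3_def)

lemma open_cone2E:
  assumes "s \<in> open_cone2 a b"
  obtains \<alpha> \<beta> where "0 < \<alpha>" "0 < \<beta>" "s = \<alpha> *\<^sub>R a + \<beta> *\<^sub>R b"
  using assms by (auto simp: open_cone2_def)

lemma open_cone2_commute: "open_cone2 a b = open_cone2 b a"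
proof -
  have "open_cone2 a b \<subseteq> open_cone2 b a" for a b
    by (auto simp: open_cone2_def) (metis add.commute)
  then show ?thesis by blast
qed

lemma open_cone3_swap12: "open_cone3 a b c = open_cone3 b a c"
proof -
  have "open_cone3 a b c \<subseteq> open_cone3 b a c" for a b
  proof
    fix x assume "x \<in> open_cone3 a b c"
    then obtain \<alpha> \<beta> \<gamma> where *: "x = \<alpha> *\<^sub>R a + \<beta> *\<^sub>R b + \<gamma> *\<^sub>R c" "0 < \<alpha>" "0 < \<beta>" "0 < \<gamma>"
      by (auto simp: open_cone3_def)
    then show "x \<in> open_cone3 b a c"
      using open_cone3I[of \<beta> \<alpha> \<gamma> b a c] by (simp add: add.commute)
  qed
  then show ?thesis by blast
qed

lemma open_cone3_swap23: "open_cone3 a b c = open_cone3 a c b"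
proof -
  have "open_cone3 a b c \<subseteq> open_cone3 a c b" for b c
  proof
    fix x assume "x \<in> open_cone3 a b c"
    then obtain \<alpha> \<beta> \<gamma> where *: "x = \<alpha> *\<^sub>R a + \<beta> *\<^sub>R b + \<gamma> *\<^sub>R c" "0 < \<alpha>" "0 < \<beta>" "0 < \<gamma>"
      by (auto simp: open_cone3_def)
    then show "x \<in> open_cone3 a c b"
      using open_cone3I[of \<alpha> \<gamma> \<beta> a c b] by (simp add: ac_simps)
  qed
  then show ?thesis by blast
qed

text \<open>Walking from a point of an arc towards one end stays on the arc. With the exit lemmas
  below, this turns leaving a triangle into a crossing of two arcs.\<close>

lemma open_cone2_add:
  assumes "s \<in> open_cone2 f g" "0 < t"
  shows "s + t *\<^sub>R f \<in> open_cone2 f g"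
proof -
  obtain \<alpha> \<beta> where *: "0 < \<alpha>" "0 < \<beta>" "s = \<alpha> *\<^sub>R f + \<beta> *\<^sub>R g"
    using assms(1) by (rule open_cone2E)
  have "s + t *\<^sub>R f = (\<alpha> + t) *\<^sub>R f + \<beta> *\<^sub>R g" using * by (simp add: algebra_simps)
  moreover have "0 < \<alpha> + t" using * assms(2) by simp
  ultimately show ?thesis using open_cone2I[of "\<alpha> + t" \<beta> f g] * by metis
qed

text \<open>A segment entering a triangle with corners \<open>a\<close>, \<open>p\<close>, \<open>w\<close> through the side \<open>a w\<close> ends in the triangle or
  leaves it through one of the other two sides. Here and below, points stand for the rays through them.\<close>

lemma exit_side:
  fixes a p w :: "'a::real_vector"
  assumes s: "s = s1 *\<^sub>R a + s2 *\<^sub>R w" and s12: "0 < s1" "0 < s2"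
    and f: "f = \<alpha> *\<^sub>R a + \<beta> *\<^sub>R p + \<gamma> *\<^sub>R w" and \<beta>: "0 < \<beta>"
  obtains "0 \<le> \<alpha>" "0 \<le> \<gamma>"
  | t x y where "0 < t" "0 < x" "0 \<le> y" "s + t *\<^sub>R f = x *\<^sub>R p + y *\<^sub>R w"
  | t x y where "0 < t" "0 < x" "0 < y" "s + t *\<^sub>R f = x *\<^sub>R a + y *\<^sub>R p"
proof -
  have st: "s + t *\<^sub>R f = (s1 + t * \<alpha>) *\<^sub>R a + (t * \<beta>) *\<^sub>R p + (s2 + t * \<gamma>) *\<^sub>R w" for t
    unfolding s f by (simp add: algebra_simps)
  \<comment> \<open>As t grows, the coordinates at \<open>a\<close> and \<open>w\<close> vanish at t
    = - s1 / \<alpha> and t = - s2 / \<gamma> if they decrease. The earlier of the two decides the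
    side; a tie means passing through \<open>p\<close> and is counted with the side
    \<open>p w\<close>.\<close>
  consider "0 \<le> \<alpha>" "0 \<le> \<gamma>" | "\<alpha> < 0" "0 \<le> s2 + (- s1 / \<alpha>) * \<gamma>"
    | "\<gamma> < 0" "0 < s1 + (- s2 / \<gamma>) * \<alpha>"
  proof (cases "\<alpha> < 0")
    case True
    show thesis
    proof (cases "0 \<le> s2 + (- s1 / \<alpha>) * \<gamma>")
      case False
      then have *: "s2 * \<alpha> > s1 * \<gamma>" using True by (simp add: field_simps)
      moreover have "s2 * \<alpha> < 0" using True s12 by (simp add: mult_pos_neg)
      ultimately have "s1 * \<gamma> < 0" by linarith
      then have g: "\<gamma> < 0" using s12 by (simp add: mult_less_0_iff)
      then have "0 < s1 + (- s2 / \<gamma>) * \<alpha>" using * by (simp add: field_simps)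
      then show thesis using that g by blast
    qed (use that True in blast)
  next
    case False
    show thesis
    proof (cases "\<gamma> < 0")
      case True
      then have "0 \<le> (- s2 / \<gamma>) * \<alpha>" using False s12 by (intro mult_nonneg_nonneg) (auto simp: divide_le_0_iff)
      then show thesis using that True s12 by linarith
    qed (use that False in auto)
  qed
  then show thesis
  proof cases
    case 2
    then show thesis using s12 \<beta> st[of "- s1 / \<alpha>"]
      by (intro that(2)[of "- s1 / \<alpha>" "(- s1 / \<alpha>) * \<beta>" "s2 + (- s1 / \<alpha>) * \<gamma>"])
        (auto simp: divide_less_0_iff mult_less_0_iff)
  next
    case 3
    then show thesis using s12 \<beta> st[of "- s2 / \<gamma>"]
      by (intro that(3)[of "- s2 / \<gamma>" "s1 + (- s2 / \<gamma>) * \<alpha>" "(- s2 / \<gamma>) * \<beta>"])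
        (auto simp: divide_less_0_iff mult_less_0_iff)
  qed (use that in blast)
qed

text \<open>Subtracting \<open>s0 *\<^sub>R a\<close> slides the start onto the side
  \<open>b w\<close>, where \<open>exit_side\<close> applies. Adding it back only enlarges the
  coefficient of \<open>a\<close>, and since that coefficient grows, the side \<open>b w\<close> is
  never an exit.\<close>

lemma exit_interior:
  fixes a b w :: "'a::real_vector"
  assumes s: "s = s0 *\<^sub>R a + s1 *\<^sub>R b + s2 *\<^sub>R w" and s12: "0 < s0" "0 < s1" "0 < s2"
    and f: "f = \<alpha> *\<^sub>R a + \<beta> *\<^sub>R b + \<gamma> *\<^sub>R w" and \<alpha>: "0 < \<alpha>"
  obtains "0 \<le> \<beta>" "0 \<le> \<gamma>"
  | t x y where "0 < t" "0 < x" "0 \<le> y" "s + t *\<^sub>R f = x *\<^sub>R a + y *\<^sub>R b"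
  | t x y where "0 < t" "0 < x" "0 \<le> y" "s + t *\<^sub>R f = x *\<^sub>R a + y *\<^sub>R w"
proof -
  have s': "s - s0 *\<^sub>R a = s1 *\<^sub>R b + s2 *\<^sub>R w" using s by simp
  have f': "f = \<beta> *\<^sub>R b + \<alpha> *\<^sub>R a + \<gamma> *\<^sub>R w" using f by (simp add: algebra_simps)
  from s' s12(2,3) f' \<alpha> show thesis
  proof (cases rule: exit_side)
    case (2 t x y)
    then have "s + t *\<^sub>R f = (s0 + x) *\<^sub>R a + y *\<^sub>R w" by (simp add: algebra_simps)
    then show thesis using that(3)[of t "s0 + x" y] 2 s12 by simp
  next
    case (3 t x y)
    then have "s + t *\<^sub>R f = (s0 + y) *\<^sub>R a + x *\<^sub>R b" by (simp add: algebra_simps)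
    then show thesis using that(2)[of t "s0 + y" x] 3 s12 by simp
  qed (use that in blast)
qed

subsection \<open>Maximal families of noncrossing arcs\<close>

definition generic_set :: "(real^3) set \<Rightarrow> bool" where
  "generic_set V \<longleftrightarrow>
     (\<forall>a\<in>V. \<forall>b\<in>V. \<forall>c\<in>V. a \<noteq> b \<longrightarrow> b \<noteq> c \<longrightarrow> a \<noteq> c \<longrightarrow> det3 a b c \<noteq> 0)"

definition balanced_set :: "(real^3) set \<Rightarrow> bool" where
  "balanced_set V \<longleftrightarrow> (\<forall>w. w \<noteq> 0 \<longrightarrow> (\<exists>v\<in>V. v \<bullet> w < 0))"

text \<open>Only the interiors of arcs are compared. That an arc avoids all vertices other than its
  ends comes from generic position.\<close>

definition noncrossing :: "(real^3) set set \<Rightarrow> bool" where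
  "noncrossing M \<longleftrightarrow> (\<forall>a b c d. {a, b} \<in> M \<longrightarrow> {c, d} \<in> M \<longrightarrow> {a, b} \<noteq> {c, d} \<longrightarrow>
     open_cone2 a b \<inter> open_cone2 c d = {})"

lemma generic_setD:
  "generic_set V \<Longrightarrow> a \<in> V \<Longrightarrow> b \<in> V \<Longrightarrow> c \<in> V \<Longrightarrow> a \<noteq> b \<Longrightarrow> b \<noteq> c \<Longrightarrow> a \<noteq> c \<Longrightarrow> det3 a b c \<noteq> 0"
  by (simp add: generic_set_def)

text \<open>The factor \<open>x\<close> is arbitrary: a positive one says that arcs pass through no
  further vertex, and x = 0 that their cones miss the origin.\<close>

lemma generic_vertex_notin_cone:
  assumes "generic_set V" "a \<in> V" "f \<in> V" "g \<in> V" "a \<noteq> f" "a \<noteq> g" "f \<noteq> g"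
  shows "x *\<^sub>R a \<notin> open_cone2 f g"
proof
  assume "x *\<^sub>R a \<in> open_cone2 f g"
  then obtain \<alpha> \<beta> where *: "0 < \<alpha>" "0 < \<beta>" "x *\<^sub>R a = \<alpha> *\<^sub>R f + \<beta> *\<^sub>R g" by (rule open_cone2E)
  have "det3 a (x *\<^sub>R a) g = \<alpha> * det3 a f g" unfolding *(3) by simp
  moreover have "det3 a (x *\<^sub>R a) g = 0" by simp
  ultimately show False using * generic_setD[of V a f g] assms by simp
qed

lemma generic_cones_share_vertex:
  assumes "generic_set V" "f \<in> V" "g \<in> V" "h \<in> V" "f \<noteq> g" "f \<noteq> h" "g \<noteq> h"
  shows "open_cone2 f g \<inter> open_cone2 f h = {}"
proof (rule ccontr)
  assume "open_cone2 f g \<inter> open_cone2 f h \<noteq> {}"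
  then obtain s where s: "s \<in> open_cone2 f g" "s \<in> open_cone2 f h" by blast
  from s(1) obtain \<alpha> \<beta> where 1: "0 < \<alpha>" "0 < \<beta>" "s = \<alpha> *\<^sub>R f + \<beta> *\<^sub>R g" by (rule open_cone2E)
  from s(2) obtain \<alpha>' \<beta>' where 2: "0 < \<alpha>'" "0 < \<beta>'" "s = \<alpha>' *\<^sub>R f + \<beta>' *\<^sub>R h" by (rule open_cone2E)
  have "det3 f g s = 0" unfolding 1(3) by simp
  moreover have "det3 f g s = \<beta>' * det3 f g h" unfolding 2(3) by simp
  ultimately show False using 2 generic_setD[of V f g h] assms by simp
qed

lemma generic_crossing_disjoint:
  assumes "generic_set V" "f \<in> V" "g \<in> V" "a \<in> V" "b \<in> V" "f \<noteq> g" "a \<noteq> b" "{f, g} \<noteq> {a, b}"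
    and s: "s \<in> open_cone2 f g" "s \<in> open_cone2 a b"
  shows "f \<noteq> a" "f \<noteq> b" "g \<noteq> a" "g \<noteq> b"
proof -
  note share = generic_cones_share_vertex[OF assms(1)]
  show "f \<noteq> a" using share[of f g b] assms by auto
  show "f \<noteq> b" using share[of f g a] assms open_cone2_commute[of a b] by auto
  show "g \<noteq> a" using share[of g f b] assms open_cone2_commute[of f g] by auto
  show "g \<noteq> b" using share[of g f a] assms open_cone2_commute[of a b] open_cone2_commute[of f g] by auto
qed

lemma finite_has_max:
  fixes \<rho> :: "'a \<Rightarrow> real"
  assumes "finite W" "W \<noteq> {}"
  shows "\<exists>v\<in>W. \<forall>v'\<in>W. \<rho> v' \<le> \<rho> v"
proof -
  have "finite (\<rho> ` W)" "\<rho> ` W \<noteq> {}" using assms by auto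
  then have "Max (\<rho> ` W) \<in> \<rho> ` W" by (rule Max_in)
  then obtain v where "v \<in> W" "\<rho> v = Max (\<rho> ` W)" by auto
  then show ?thesis using assms(1) by (metis Max_ge finite_imageI imageI)
qed

text \<open>Maximality is stated for single arcs: a segment between two vertices that crosses no
  other member is itself a member. The triangles are not part of the data but are recovered from the
  arcs.\<close>

locale arc_triangulation =
  fixes V :: "(real^3) set" and M :: "(real^3) set set"
  assumes finite_V: "finite V" and generic: "generic_set V" and bal: "balanced_set V"
    and card3: "3 \<le> card V"
    and arcs: "M \<subseteq> {{a, b} | a b. a \<in> V \<and> b \<in> V \<and> a \<noteq> b}"
    and nonx: "noncrossing M"
    and maximal: "\<And>a b. \<lbrakk>a \<in> V; b \<in> V; a \<noteq> b;
        \<And>c d. {c, d} \<in> M \<Longrightarrow> {c, d} \<noteq> {a, b} \<Longrightarrow> open_cone2 a b \<inter> open_cone2 c d = {}\<rbrakk>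
        \<Longrightarrow> {a, b} \<in> M"
begin

lemma arcD: "{a, b} \<in> M \<Longrightarrow> a \<in> V" "{a, b} \<in> M \<Longrightarrow> b \<in> V" "{a, b} \<in> M \<Longrightarrow> a \<noteq> b"
  using arcs by (auto simp: doubleton_eq_iff dest!: subsetD)

lemmas det3_nz = generic_setD[OF generic]
lemmas notin_cone = generic_vertex_notin_cone[OF generic]

lemma crossing_arc_disjoint:
  assumes "{f, g} \<in> M" "a \<in> V" "b \<in> V" "a \<noteq> b" "{f, g} \<noteq> {a, b}"
    and "s \<in> open_cone2 f g" "s \<in> open_cone2 a b"
  shows "f \<noteq> a" "f \<noteq> b" "g \<noteq> a" "g \<noteq> b"
  using generic_crossing_disjoint[OF generic _ _ assms(2,3) _ assms(4,5,6,7)] arcD[OF assms(1)] by auto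

lemma arcs_disjoint:
  assumes "{a, b} \<in> M" "{c, d} \<in> M" "s \<in> open_cone2 a b" "s \<in> open_cone2 c d"
  shows "{a, b} = {c, d}"
  using nonx assms unfolding noncrossing_def by blast

text \<open>This is how balance enters the triangulation: it is applied to the normal of the plane
  of \<open>a\<close> and \<open>b\<close>, which a third vertex shows to be nonzero. Exchanging
  \<open>a\<close> and \<open>b\<close> gives a vertex on the other side.\<close>

lemma exists_left_vertex:
  assumes "a \<in> V" "b \<in> V" "a \<noteq> b"
  obtains c where "c \<in> V" "0 < det3 a b c"
proof -
  have "\<not> V \<subseteq> {a, b}"
    using card3 card_mono[of "{a, b}" V] card_insert_le_m1[of 2 "{b}" a] by auto
  then obtain z where "z \<in> V" "z \<noteq> a" "z \<noteq> b" by auto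
  then have "det3 a b z \<noteq> 0" using det3_nz[of a b z] assms by auto
  then have "- cross3 a b \<noteq> 0" by (auto simp: det3_inner)
  then obtain c where "c \<in> V" "c \<bullet> (- cross3 a b) < 0" using bal unfolding balanced_set_def by blast
  then show thesis using that[of c] by (simp add: det3_inner)
qed

text \<open>Take a vertex \<open>c\<^sub>0\<close> to the left of \<open>a b\<close>. If \<open>a c\<^sub>0\<close> is crossed, let \<open>d e\<close> be the arc crossing it nearest to
  \<open>a\<close>, at \<open>y\<close>. Among the vertices of the triangle \<open>a y d\<close>, the one at the least angle from \<open>y\<close> as seen from
  \<open>a\<close> is joined to \<open>a\<close> by an uncrossed segment.\<close>

lemma left_arc_exists:
  assumes ab: "{a, b} \<in> M"
  obtains c where "{a, c} \<in> M" "0 < det3 a b c"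
proof -
  have abV: "a \<in> V" "b \<in> V" "a \<noteq> b" using arcD[OF ab] .
  obtain c0 where c0: "c0 \<in> V" "0 < det3 a b c0" using exists_left_vertex abV by blast
  have c0a: "a \<noteq> c0" using c0(2) by auto
  \<comment> \<open>The points \<open>a + t *\<^sub>R c0\<close> with t > 0 run through the
    directions of the open arc from \<open>a\<close> to \<open>c0\<close>, so the least crossed
    parameter is the crossing nearest to \<open>a\<close>.\<close>
  define crossed where "crossed t \<longleftrightarrow> 0 < t \<and>
     (\<exists>d e. {d, e} \<in> M \<and> {d, e} \<noteq> {a, c0} \<and> a + t *\<^sub>R c0 \<in> open_cone2 d e)" for t
  have on: "a + t *\<^sub>R c0 \<in> open_cone2 a c0" if "0 < t" for t
    using open_cone2I[of 1 t a c0] that by simp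
  show thesis
  proof (cases "\<exists>t. crossed t")
    case False
    have "{a, c0} \<in> M"
    proof (rule maximal[OF abV(1) c0(1) c0a])
      fix c d assume cd: "{c, d} \<in> M" "{c, d} \<noteq> {a, c0}"
      show "open_cone2 a c0 \<inter> open_cone2 c d = {}"
      proof (rule ccontr)
        assume "open_cone2 a c0 \<inter> open_cone2 c d \<noteq> {}"
        then obtain s where s: "s \<in> open_cone2 a c0" "s \<in> open_cone2 c d" by blast
        obtain \<alpha> \<beta> where *: "0 < \<alpha>" "0 < \<beta>" "s = \<alpha> *\<^sub>R a + \<beta> *\<^sub>R c0" using s(1) by (rule open_cone2E)
        obtain \<gamma> \<delta> where **: "0 < \<gamma>" "0 < \<delta>" "s = \<gamma> *\<^sub>R c + \<delta> *\<^sub>R d" using s(2) by (rule open_cone2E)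
        have "a + (\<beta> / \<alpha>) *\<^sub>R c0 = (1 / \<alpha>) *\<^sub>R s" using * by (simp add: algebra_simps)
        also have "\<dots> = (\<gamma> / \<alpha>) *\<^sub>R c + (\<delta> / \<alpha>) *\<^sub>R d" unfolding **(3) by (simp add: algebra_simps)
        also have "\<dots> \<in> open_cone2 c d" using * ** by (intro open_cone2I) auto
        finally have "crossed (\<beta> / \<alpha>)" unfolding crossed_def using cd * by auto
        then show False using False by blast
      qed
    qed
    then show thesis using that c0 by blast
  next
    case True
    \<comment> \<open>A crossing parameter is determined by the ends \<open>d\<close>,
      \<open>e\<close> of the crossing arc, as the zero of
      \<open>det3 (a + t *\<^sub>R c0) d e\<close>. Hence there are finitely many.\<close>
    have "Collect crossed \<subseteq> (\<lambda>(d, e). - det3 a d e / det3 c0 d e) ` (V \<times> V)"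
    proof
      fix t assume "t \<in> Collect crossed"
      then obtain d e where t: "0 < t" and de: "{d, e} \<in> M" "{d, e} \<noteq> {a, c0}" "a + t *\<^sub>R c0 \<in> open_cone2 d e"
        by (auto simp: crossed_def)
      note dist = crossing_arc_disjoint[OF de(1) abV(1) c0(1) c0a de(2,3) on[OF t]]
      obtain \<gamma> \<delta> where **: "a + t *\<^sub>R c0 = \<gamma> *\<^sub>R d + \<delta> *\<^sub>R e" using de(3) by (rule open_cone2E)
      have "det3 (a + t *\<^sub>R c0) d e = 0" unfolding ** by simp
      then have "det3 a d e + t * det3 c0 d e = 0" by simp
      moreover have "det3 c0 d e \<noteq> 0" using det3_nz[of c0 d e] dist arcD[OF de(1)] c0 by auto
      ultimately have "t = - det3 a d e / det3 c0 d e" by (simp add: field_simps)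
      then show "t \<in> (\<lambda>(d, e). - det3 a d e / det3 c0 d e) ` (V \<times> V)" using arcD[OF de(1)] by auto
    qed
    then have fin: "finite (Collect crossed)" by (rule finite_subset) (simp add: finite_V)
    define t0 where "t0 = Min (Collect crossed)"
    have "crossed t0" using Min_in[OF fin] True by (auto simp: t0_def)
    have t0_min: "t0 \<le> t" if "crossed t" for t using fin that by (simp add: t0_def)
    define y where "y = a + t0 *\<^sub>R c0"
    \<comment> \<open>As \<open>y\<close> lies to the left of \<open>a b\<close>, so does one end of
      the crossing arc; \<open>d\<close> names that end.\<close>
    obtain d e where t0: "0 < t0" and de: "{d, e} \<in> M" "{d, e} \<noteq> {a, c0}" "y \<in> open_cone2 d e"
        and d_left: "0 < det3 a b d"
    proof -
      obtain d e where t0: "0 < t0" and de: "{d, e} \<in> M" "{d, e} \<noteq> {a, c0}" "y \<in> open_cone2 d e"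
        using \<open>crossed t0\<close> by (auto simp: crossed_def y_def)
      obtain \<gamma> \<delta> where **: "0 < \<gamma>" "0 < \<delta>" "y = \<gamma> *\<^sub>R d + \<delta> *\<^sub>R e" using de(3) by (rule open_cone2E)
      have "0 < det3 a b y" unfolding y_def using t0 c0 by simp
      then have "0 < \<gamma> * det3 a b d + \<delta> * det3 a b e" unfolding ** by simp
      then have "0 < det3 a b d \<or> 0 < det3 a b e" using **(1,2)
        by (smt (verit) mult_pos_neg zero_less_mult_iff)
      then show thesis using that[of d e] that[of e d] t0 de
        by (auto simp: insert_commute open_cone2_commute)
    qed
    note dist = crossing_arc_disjoint[OF de(1) abV(1) c0(1) c0a de(2) de(3)[unfolded y_def] on[OF t0]]
    have deV: "d \<in> V" "e \<in> V" "d \<noteq> e" using arcD[OF de(1)] .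
    obtain \<delta> \<epsilon> where y_de: "0 < \<delta>" "0 < \<epsilon>" "y = \<delta> *\<^sub>R d + \<epsilon> *\<^sub>R e" using de(3) by (rule open_cone2E)
    have D: "det3 a y d \<noteq> 0" unfolding y_def using t0 det3_nz[of a c0 d] abV c0 c0a deV dist by auto
    have y_left: "0 < det3 a b y" unfolding y_def using t0 c0 by simp
    \<comment> \<open>The vertices of the closed triangle \<open>a y d\<close> off its side
      \<open>a y\<close>; \<open>d\<close> is one of them. The ratio \<open>\<rho>\<close>, here
      \<beta> / \<gamma>, grows as the angle at \<open>a\<close> with the side \<open>a y\<close>
      shrinks.\<close>
    define W where "W = {v \<in> V. \<exists>\<alpha> \<beta> \<gamma>. 0 \<le> \<alpha> \<and> 0 \<le> \<beta> \<and> 0 < \<gamma> \<and> v = \<alpha> *\<^sub>R a + \<beta> *\<^sub>R y + \<gamma> *\<^sub>R d}"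
    define \<rho> where "\<rho> v = det3 a v d / det3 a y v" for v
    have \<rho>: "\<rho> (\<alpha> *\<^sub>R a + \<beta> *\<^sub>R y + \<gamma> *\<^sub>R d) = \<beta> / \<gamma>" for \<alpha> \<beta> \<gamma>
      using D by (simp add: \<rho>_def)
    have "d \<in> W" unfolding W_def using deV
      by (intro CollectI conjI exI[of _ 0] exI[of _ 0] exI[of _ 1]) auto
    then have "finite W" "W \<noteq> {}" unfolding W_def using finite_V by auto
    from finite_has_max[OF this, of \<rho>]
    obtain v where vW: "v \<in> W" and v_max: "\<forall>v'\<in>W. \<rho> v' \<le> \<rho> v" by (rule bexE)
    obtain \<alpha> \<beta> \<gamma> where v: "v \<in> V" "0 \<le> \<alpha>" "0 \<le> \<beta>" "0 < \<gamma>" "v = \<alpha> *\<^sub>R a + \<beta> *\<^sub>R y + \<gamma> *\<^sub>R d"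
      using vW unfolding W_def by blast
    have v_left: "0 < det3 a b v" unfolding v(5) using v y_left d_left by (simp add: add_nonneg_pos)
    have av: "a \<noteq> v" using v_left by auto
    \<comment> \<open>The point where the ray from \<open>a\<close> through \<open>v\<close> meets
      the side \<open>y d\<close>. The arc \<open>a v\<close> thus runs along the side
      \<open>a w\<close> of the triangle \<open>a y w\<close>, and a vertex inside that triangle
      would beat \<open>v\<close>.\<close>
    define w where "w = \<beta> *\<^sub>R y + \<gamma> *\<^sub>R d"
    have vw: "v = \<alpha> *\<^sub>R a + w" unfolding v w_def by simp
    have Dw: "det3 a y w \<noteq> 0" unfolding w_def using D v by simp
    have "{a, v} \<in> M"
    proof (rule maximal[OF abV(1) v(1) av], rule ccontr)
      fix f' g' assume fg': "{f', g'} \<in> M" "{f', g'} \<noteq> {a, v}" and "open_cone2 a v \<inter> open_cone2 f' g' \<noteq> {}"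
      then obtain s where s: "s \<in> open_cone2 a v" "s \<in> open_cone2 f' g'" by blast
      obtain s1 s2 where s12: "0 < s1" "0 < s2" "s = s1 *\<^sub>R a + s2 *\<^sub>R v" using s(1) by (rule open_cone2E)
      have s_w: "s = (s1 + s2 * \<alpha>) *\<^sub>R a + s2 *\<^sub>R w" unfolding s12 vw by (simp add: algebra_simps)
      have s1': "0 < s1 + s2 * \<alpha>" using s12 v by (simp add: add_pos_nonneg)
      have dist': "f' \<noteq> a" "f' \<noteq> v" "g' \<noteq> a" "g' \<noteq> v"
        using crossing_arc_disjoint[OF fg'(1) abV(1) v(1) av fg'(2) s(2) s(1)] .
      have f'g'V: "f' \<in> V" "g' \<in> V" "f' \<noteq> g'" using arcD[OF fg'(1)] .
      \<comment> \<open>The \<open>y\<close>-coordinate in the basis \<open>a\<close>,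
        \<open>y\<close>, \<open>w\<close>. It vanishes at the crossing point, so the ends of the
        crossing arc have opposite signs, and \<open>f\<close> is the end on the side of
        \<open>y\<close>.\<close>
      define L where "L z = det3 a z w / det3 a y w" for z
      have L: "L (i *\<^sub>R a + j *\<^sub>R y + k *\<^sub>R w) = j" for i j k using Dw by (simp add: L_def)
      obtain \<phi> \<eta> where fgs: "0 < \<phi>" "0 < \<eta>" "s = \<phi> *\<^sub>R f' + \<eta> *\<^sub>R g'" using s(2) by (rule open_cone2E)
      have "\<phi> * L f' + \<eta> * L g' = L s" unfolding fgs(3) L_def by (simp add: add_divide_distrib)
      also have "L s = 0" unfolding s_w L_def by simp
      finally have L0: "\<phi> * L f' + \<eta> * L g' = 0" .
      have "det3 a f' v \<noteq> 0" using det3_nz[of a f' v] abV v f'g'V dist' av by auto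
      then have "det3 a f' w \<noteq> 0" unfolding vw by simp
      then have "L f' \<noteq> 0" using Dw by (simp add: L_def)
      then have "0 < L f' \<or> 0 < L g'" using L0 fgs(1,2)
        by (smt (verit) mult_pos_neg zero_less_mult_iff)
      then obtain f g where fg: "{f, g} \<in> M" "f \<noteq> a" "g \<noteq> a" "f \<in> V" "g \<in> V" "f \<noteq> g" "s \<in> open_cone2 f g" "0 < L f"
      proof
        assume "0 < L f'"
        then show thesis using that[of f' g'] fg' dist' f'g'V s(2) by auto
      next
        assume "0 < L g'"
        then show thesis using that[of g' f'] fg' dist' f'g'V s(2)
          by (auto simp: insert_commute open_cone2_commute[of g' f'])
      qed
      obtain i j k where f: "f = i *\<^sub>R a + j *\<^sub>R y + k *\<^sub>R w" using det3_coords[OF Dw] .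
      have j: "0 < j" using fg(8) unfolding f L .
      \<comment> \<open>If \<open>f\<close> is in the triangle, it either beats \<open>v\<close> or
        lies in the plane of \<open>a\<close> and \<open>c0\<close>, hence is \<open>c0\<close>,
        which is impossible. Leaving through \<open>y w\<close> would meet the arc
        \<open>d e\<close>, and leaving through \<open>a y\<close> would cross \<open>a c0\<close>
        before \<open>y\<close>.\<close>
      from s_w s1' s12(2) f j show False
      proof (cases rule: exit_side)
        case 1
        have fa: "f = i *\<^sub>R a + (j + k * \<beta>) *\<^sub>R y + (k * \<gamma>) *\<^sub>R d" unfolding f w_def by (simp add: algebra_simps)
        show False
        proof (cases "k = 0")
          case True
          have fc: "f = (i + j) *\<^sub>R a + (j * t0) *\<^sub>R c0" unfolding fa True y_def by (simp add: algebra_simps)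
          have "f = c0"
          proof (rule ccontr)
            assume "f \<noteq> c0"
            moreover have "det3 a c0 f = 0" by (subst fc) simp
            ultimately show False using det3_nz[of a c0 f] abV c0 c0a fg by auto
          qed
          then have "det3 b c0 f = 0" by simp
          then have "(i + j) * det3 b c0 a = 0" by (subst (asm) fc) simp
          then show False using c0(2) det3_rotate[of b c0 a] j 1 by simp
        next
          case False
          then have k: "0 < k" using 1 by simp
          have "f \<in> W" unfolding W_def using fg(4) fa 1 j k v
            by (intro CollectI conjI exI[of _ i] exI[of _ "j + k * \<beta>"] exI[of _ "k * \<gamma>"]) auto
          then have "\<rho> f \<le> \<rho> v" by (rule v_max[rule_format])
          then have "(j + k * \<beta>) / (k * \<gamma>) \<le> \<beta> / \<gamma>" unfolding fa v(5) \<rho> .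
          moreover have "0 < \<gamma> * j" using j v by simp
          ultimately show False using k v(4) by (simp add: field_simps)
        qed
      next
        case (2 t x z)
        have "s + t *\<^sub>R f \<in> open_cone2 f g" using fg(7) 2(1) by (rule open_cone2_add)
        moreover have "s + t *\<^sub>R f = ((x + z * \<beta>) * \<delta> + z * \<gamma>) *\<^sub>R d + ((x + z * \<beta>) * \<epsilon>) *\<^sub>R e"
          unfolding 2(4) w_def y_de(3) by (simp add: algebra_simps)
        moreover have "0 < x + z * \<beta>" using 2 v by (simp add: add_pos_nonneg)
        ultimately have "s + t *\<^sub>R f \<in> open_cone2 d e" using y_de 2 v
          by (auto intro!: open_cone2I add_pos_nonneg)
        then have "{f, g} = {d, e}" using arcs_disjoint[OF fg(1) de(1)] \<open>s + t *\<^sub>R f \<in> open_cone2 f g\<close> by blast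
        then have "s \<in> open_cone2 d e" using fg(7) by (metis doubleton_eq_iff open_cone2_commute)
        then obtain p q where pq: "s = p *\<^sub>R d + q *\<^sub>R e" by (rule open_cone2E)
        have "det3 s d y = 0" unfolding pq y_de(3) by (simp add: det3_swap23[of d e])
        moreover have "det3 s d y = (s1 + s2 * \<alpha>) * det3 a d y" unfolding s_w w_def by simp
        ultimately show False using s1' D det3_swap23[of a y d] by simp
      next
        case (3 t x z)
        have "s + t *\<^sub>R f \<in> open_cone2 f g" using fg(7) 3(1) by (rule open_cone2_add)
        then obtain p q where pq: "0 < p" "0 < q" "s + t *\<^sub>R f = p *\<^sub>R f + q *\<^sub>R g" by (rule open_cone2E)
        have "a + (z * t0 / (x + z)) *\<^sub>R c0 = (1 / (x + z)) *\<^sub>R (x *\<^sub>R a + z *\<^sub>R y)"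
          unfolding y_def using 3 by (simp add: algebra_simps flip: scaleR_add_left add_divide_distrib)
        also have "\<dots> = (p / (x + z)) *\<^sub>R f + (q / (x + z)) *\<^sub>R g"
          unfolding 3(4)[symmetric] pq(3) by (simp add: algebra_simps)
        also have "\<dots> \<in> open_cone2 f g" using pq 3 by (intro open_cone2I) auto
        finally have on_fg: "a + (z * t0 / (x + z)) *\<^sub>R c0 \<in> open_cone2 f g" .
        have "{f, g} \<noteq> {a, c0}" using fg by (auto simp: doubleton_eq_iff)
        moreover have "0 < z * t0 / (x + z)" using 3 t0 by simp
        ultimately have "crossed (z * t0 / (x + z))" unfolding crossed_def using fg(1) on_fg by blast
        then have "t0 \<le> z * t0 / (x + z)" by (rule t0_min)
        moreover have "0 < t0 * x" using 3 t0 by simp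
        ultimately show False using 3(2,3) by (simp add: field_simps)
      qed
    qed
    then show thesis using that v_left by blast
  qed
qed

end

text \<open>The three-term Pluecker relation. Projected from \<open>a\<close> it is an identity for
  plane determinants, used to compare angles about \<open>a\<close>.\<close>

lemma det3_pluecker:
  "det3 a c d * det3 a b e = det3 a c e * det3 a b d - det3 a b c * det3 a d e"
  unfolding det3_expand by (simp add: algebra_simps)

section \<open>Faces on the two sides of an arc\<close>

context arc_triangulation
begin

text \<open>Excluding vertices from the interior is enough: an arc meeting it would have to end
  there or cross a side.\<close>

definition face :: "real^3 \<Rightarrow> real^3 \<Rightarrow> real^3 \<Rightarrow> bool" where
  "face a b c \<longleftrightarrow> {a, b} \<in> M \<and> {b, c} \<in> M \<and> {a, c} \<in> M \<and> V \<inter> open_cone3 a b c = {}"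

lemma face_swap12: "face a b c \<Longrightarrow> face b a c"
  unfolding face_def by (metis insert_commute open_cone3_swap12)

lemma face_swap23: "face a b c \<Longrightarrow> face a c b"
  unfolding face_def by (metis insert_commute open_cone3_swap23)

lemma faceD:
  assumes "face a b c"
  shows "a \<in> V" "b \<in> V" "c \<in> V" "a \<noteq> b" "b \<noteq> c" "a \<noteq> c" "det3 a b c \<noteq> 0"
  using assms arcD[of a b] arcD[of b c] arcD[of a c] det3_nz[of a b c] unfolding face_def by auto

text \<open>The next arc \<open>a c\<close> after \<open>a b\<close> in the rotation about \<open>a\<close> bounds a face with \<open>a b\<close>: a vertex inside
  \<open>a b c\<close> at the least angle from \<open>a\<close> as seen from \<open>b\<close> would yield an intermediate arc at \<open>a\<close>.\<close>

lemma left_face_exists: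
  assumes ab: "{a, b} \<in> M"
  obtains c where "face a b c" "0 < det3 a b c"
proof -
  have abV: "a \<in> V" "b \<in> V" "a \<noteq> b" using arcD[OF ab] .
  define N where "N = {c. {a, c} \<in> M \<and> 0 < det3 a b c}"
  obtain n where n: "n \<in> N" using left_arc_exists[OF ab] unfolding N_def by blast
  have "N \<subseteq> V" unfolding N_def using arcD by blast
  then have "finite N" using finite_V finite_subset by blast
  \<comment> \<open>If \<open>z\<close> and \<open>n\<close> are seen from \<open>a\<close> at
    angles theta and phi from \<open>b\<close>, then \<open>\<rho> z\<close> is a constant positive
    multiple of sin (phi - theta) / sin theta. This decreases on (0, pi), so the maximum picks the
    first arc after \<open>a b\<close>.\<close>
  define \<rho> where "\<rho> z = det3 a z n / det3 a b z" for z
  have "N \<noteq> {}" using n by blast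
  from finite_has_max[OF \<open>finite N\<close> this, of \<rho>]
  obtain c where c: "c \<in> N" and c_max: "\<forall>z\<in>N. \<rho> z \<le> \<rho> c" by (rule bexE)
  have next_arc: "0 \<le> det3 a c z" if "z \<in> N" for z
  proof -
    have pos: "0 < det3 a b z" "0 < det3 a b c" "0 < det3 a b n" using that c n unfolding N_def by auto
    have "\<rho> z * (det3 a b z * det3 a b c) \<le> \<rho> c * (det3 a b z * det3 a b c)"
      using c_max[rule_format, OF that] pos by (intro mult_right_mono) auto
    moreover have "\<rho> z * det3 a b z = det3 a z n" "\<rho> c * det3 a b c = det3 a c n"
      using pos by (auto simp: \<rho>_def)
    ultimately have "det3 a b c * det3 a z n \<le> det3 a c n * det3 a b z"
      by (metis mult.assoc mult.commute)
    then have "0 \<le> det3 a c z * det3 a b n" by (subst det3_pluecker) simp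
    then show ?thesis using pos by (simp add: zero_le_mult_iff)
  qed
  have ac: "{a, c} \<in> M" and D: "0 < det3 a b c" using c unfolding N_def by auto
  have acb: "det3 a c b < 0" using D det3_swap23[of a b c] by simp
  have cV: "c \<in> V" "a \<noteq> c" using arcD[OF ac] by auto
  have bc: "b \<noteq> c" using D by auto
  have empty: "V \<inter> open_cone3 a b c = {}"
  proof (rule ccontr)
    assume ne: "V \<inter> open_cone3 a b c \<noteq> {}"
    define \<sigma> where "\<sigma> z = det3 z b c / det3 a b z" for z
    have \<sigma>: "\<sigma> (\<alpha> *\<^sub>R a + \<beta> *\<^sub>R b + \<gamma> *\<^sub>R c) = \<alpha> / \<gamma>" for \<alpha> \<beta> \<gamma> using D by (simp add: \<sigma>_def)
    have "finite (V \<inter> open_cone3 a b c)" using finite_V by simp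
    from finite_has_max[OF this ne, of \<sigma>]
    obtain v where "v \<in> V \<inter> open_cone3 a b c" and v_max: "\<forall>z\<in>V \<inter> open_cone3 a b c. \<sigma> z \<le> \<sigma> v"
      by (rule bexE)
    then obtain \<alpha> \<beta> \<gamma> where v: "v \<in> V" "0 < \<alpha>" "0 < \<beta>" "0 < \<gamma>" "v = \<alpha> *\<^sub>R a + \<beta> *\<^sub>R b + \<gamma> *\<^sub>R c"
      by (auto simp: open_cone3_def)
    have v_left: "0 < det3 a b v" unfolding v(5) using v D by simp
    have av: "a \<noteq> v" using v_left by auto
    \<comment> \<open>The projection of \<open>v\<close> from \<open>b\<close> to the side
      \<open>a c\<close>. A crossing of \<open>a v\<close> happens inside the triangle
      \<open>a b w\<close>, whose sides \<open>a b\<close> and \<open>a w\<close> lie on arcs of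
      \<open>M\<close>.\<close>
    define w where "w = \<alpha> *\<^sub>R a + \<gamma> *\<^sub>R c"
    have vw: "v = \<beta> *\<^sub>R b + w" unfolding v w_def by (simp add: algebra_simps)
    have Dw: "det3 a b w \<noteq> 0" unfolding w_def using D v by simp
    have "{a, v} \<in> M"
    proof (rule maximal[OF abV(1) v(1) av], rule ccontr)
      fix f' g' assume fg': "{f', g'} \<in> M" "{f', g'} \<noteq> {a, v}" and "open_cone2 a v \<inter> open_cone2 f' g' \<noteq> {}"
      then obtain s where s: "s \<in> open_cone2 a v" "s \<in> open_cone2 f' g'" by blast
      obtain s1 s2 where s12: "0 < s1" "0 < s2" "s = s1 *\<^sub>R a + s2 *\<^sub>R v" using s(1) by (rule open_cone2E)
      have s_w: "s = s1 *\<^sub>R a + (s2 * \<beta>) *\<^sub>R b + s2 *\<^sub>R w" unfolding s12 vw by (simp add: algebra_simps)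
      have s2': "0 < s2 * \<beta>" using s12 v by simp
      have dist': "f' \<noteq> a" "f' \<noteq> v" "g' \<noteq> a" "g' \<noteq> v"
        using crossing_arc_disjoint[OF fg'(1) abV(1) v(1) av fg'(2) s(2) s(1)] .
      have f'g'V: "f' \<in> V" "g' \<in> V" "f' \<noteq> g'" using arcD[OF fg'(1)] .
      \<comment> \<open>The \<open>a\<close>-coordinate in the basis \<open>a\<close>,
        \<open>b\<close>, \<open>w\<close>. It is positive at the crossing point, hence at an end
        \<open>f\<close>. Towards \<open>f\<close> the segment cannot leave through
        \<open>b w\<close>, so it crosses \<open>a b\<close> or \<open>a c\<close>, or else
        \<open>f\<close> is a better choice than \<open>v\<close>.\<close>
      define L where "L z = det3 z b w / det3 a b w" for z
      have L: "L (i *\<^sub>R a + j *\<^sub>R b + k *\<^sub>R w) = i" for i j k using Dw by (simp add: L_def)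
      obtain \<phi> \<eta> where fgs: "0 < \<phi>" "0 < \<eta>" "s = \<phi> *\<^sub>R f' + \<eta> *\<^sub>R g'" using s(2) by (rule open_cone2E)
      have "\<phi> * L f' + \<eta> * L g' = L s" unfolding fgs(3) L_def by (simp add: add_divide_distrib)
      also have "\<dots> = s1" unfolding s_w L ..
      finally have "0 < L f' \<or> 0 < L g'" using fgs(1,2) s12(1)
        by (smt (verit) mult_pos_neg zero_less_mult_iff)
      then obtain f g where fg: "{f, g} \<in> M" "f \<noteq> a" "g \<noteq> a" "f \<in> V" "g \<in> V" "f \<noteq> g" "s \<in> open_cone2 f g" "0 < L f"
      proof
        assume "0 < L f'"
        then show thesis using that[of f' g'] fg' dist' f'g'V s(2) by auto
      next
        assume "0 < L g'"
        then show thesis using that[of g' f'] fg' dist' f'g'V s(2)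
          by (auto simp: insert_commute open_cone2_commute[of g' f'])
      qed
      obtain i j k where f: "f = i *\<^sub>R a + j *\<^sub>R b + k *\<^sub>R w" using det3_coords[OF Dw] .
      have i: "0 < i" using fg(8) unfolding f L .
      have a_notin: "x *\<^sub>R a \<notin> open_cone2 f g" for x using notin_cone[of a f g x] fg abV by auto
      from s_w s12(1) s2' s12(2) f i show False
      proof (cases rule: exit_interior)
        case 1
        have fa: "f = (i + k * \<alpha>) *\<^sub>R a + j *\<^sub>R b + (k * \<gamma>) *\<^sub>R c" unfolding f w_def by (simp add: algebra_simps)
        have ik: "0 < i + k * \<alpha>" using i 1 v by (simp add: add_pos_nonneg)
        have "k \<noteq> 0"
        proof
          assume "k = 0"
          then have "f = i *\<^sub>R a + j *\<^sub>R b" using fa by simp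
          then have "det3 a b f = 0" by simp
          then have "f = b" using det3_nz[of a b f] fg abV by auto
          then have "det3 a f c = det3 a b c" "det3 f b c = 0" by auto
          then have "i * det3 a b c = 0" unfolding \<open>f = i *\<^sub>R a + j *\<^sub>R b\<close> by simp
          then show False using i D by simp
        qed
        moreover have "j \<noteq> 0"
        proof
          assume "j = 0"
          then have fc: "f = (i + k * \<alpha>) *\<^sub>R a + (k * \<gamma>) *\<^sub>R c" using fa by simp
          then have "det3 a c f = 0" by simp
          then have "f = c" using det3_nz[of a c f] fg abV cV by auto
          then have "det3 f b c = 0" by simp
          then have "(i + k * \<alpha>) * det3 a b c = 0" unfolding fc by simp
          then show False using ik D by simp
        qed
        ultimately have jk: "0 < j" "0 < k" using 1 by auto
        have "f \<in> V \<inter> open_cone3 a b c" using fg(4) ik jk v unfolding fa by (auto intro!: open_cone3I)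
        then have "\<sigma> f \<le> \<sigma> v" by (rule v_max[rule_format])
        then have "(i + k * \<alpha>) / (k * \<gamma>) \<le> \<alpha> / \<gamma>" unfolding fa v(5) \<sigma> .
        moreover have "0 < \<gamma> * i" using i v by simp
        ultimately show False using jk v(4) by (simp add: field_simps)
      next
        case (2 t x y)
        have in_fg: "s + t *\<^sub>R f \<in> open_cone2 f g" using fg(7) 2(1) by (rule open_cone2_add)
        then have "y \<noteq> 0" using a_notin[of x] 2(4) by auto
        then have "s + t *\<^sub>R f \<in> open_cone2 a b" using 2 by (auto intro!: open_cone2I)
        then show False using arcs_disjoint[OF fg(1) ab in_fg] fg by (auto simp: doubleton_eq_iff)
      next
        case (3 t x y)
        have in_fg: "s + t *\<^sub>R f \<in> open_cone2 f g" using fg(7) 3(1) by (rule open_cone2_add)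
        then have "y \<noteq> 0" using a_notin[of x] 3(4) by auto
        then have y: "0 < y" using 3 by simp
        have "s + t *\<^sub>R f = (x + y * \<alpha>) *\<^sub>R a + (y * \<gamma>) *\<^sub>R c" unfolding 3(4) w_def by (simp add: algebra_simps)
        then have "s + t *\<^sub>R f \<in> open_cone2 a c" using 3 y v by (auto intro!: open_cone2I add_pos_pos)
        then show False using arcs_disjoint[OF fg(1) ac in_fg] fg by (auto simp: doubleton_eq_iff)
      qed
    qed
    \<comment> \<open>Since \<open>v\<close> lies inside the triangle, the arc \<open>a v\<close>
      would come before \<open>a c\<close> in the rotation, against the choice of
      \<open>c\<close>.\<close>
    then have "v \<in> N" unfolding N_def using v_left by simp
    then have "0 \<le> det3 a c v" by (rule next_arc)
    moreover have "det3 a c v = \<beta> * det3 a c b" unfolding v(5) by simp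
    ultimately show False using v acb by (simp add: zero_le_mult_iff)
  qed
  have "{b, c} \<in> M"
  proof (rule maximal[OF abV(2) cV(1) bc], rule ccontr)
    fix f' g' assume fg': "{f', g'} \<in> M" "{f', g'} \<noteq> {b, c}" and "open_cone2 b c \<inter> open_cone2 f' g' \<noteq> {}"
    then obtain s where s: "s \<in> open_cone2 b c" "s \<in> open_cone2 f' g'" by blast
    obtain s1 s2 where s12: "0 < s1" "0 < s2" "s = s1 *\<^sub>R b + s2 *\<^sub>R c" using s(1) by (rule open_cone2E)
    have dist': "f' \<noteq> b" "f' \<noteq> c" "g' \<noteq> b" "g' \<noteq> c"
      using crossing_arc_disjoint[OF fg'(1) abV(2) cV(1) bc fg'(2) s(2) s(1)] .
    \<comment> \<open>An arc from \<open>a\<close> across \<open>b c\<close> would lie strictly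
      between \<open>a b\<close> and \<open>a c\<close>, where the choice of \<open>c\<close> admits
      none. An arc crossing \<open>b c\<close> with no end at \<open>a\<close> is then excluded by
      the exit argument.\<close>
    have not_a: "g \<noteq> a" if fg: "{f, g} \<in> M" "s \<in> open_cone2 f g" for f g
    proof
      assume "g = a"
      obtain \<phi> \<eta> where fgs: "0 < \<phi>" "0 < \<eta>" "s = \<phi> *\<^sub>R f + \<eta> *\<^sub>R g" using fg(2) by (rule open_cone2E)
      have "det3 a b s = s2 * det3 a b c" "det3 a c s = s1 * det3 a c b" unfolding s12 by simp_all
      then have s_det: "0 < det3 a b s" "det3 a c s < 0" using s12 D acb by (auto simp: mult_pos_neg)
      then have "0 < \<phi> * det3 a b f" "\<phi> * det3 a c f < 0" unfolding fgs \<open>g = a\<close> by simp_all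
      then have "0 < det3 a b f" "det3 a c f < 0" using fgs(1) by (auto simp: zero_less_mult_iff mult_less_0_iff)
      moreover have "{a, f} \<in> M" using fg(1) \<open>g = a\<close> by (simp add: insert_commute)
      ultimately show False using next_arc[of f] unfolding N_def by auto
    qed
    have f'g'V: "f' \<in> V" "g' \<in> V" "f' \<noteq> g'" using arcD[OF fg'(1)] .
    have f'a: "f' \<noteq> a" "g' \<noteq> a" using not_a[of f' g'] not_a[of g' f'] fg' s(2)
      by (auto simp: insert_commute open_cone2_commute)
    define L where "L z = det3 z b c" for z
    obtain \<phi> \<eta> where fgs: "0 < \<phi>" "0 < \<eta>" "s = \<phi> *\<^sub>R f' + \<eta> *\<^sub>R g'" using s(2) by (rule open_cone2E)
    have "\<phi> * L f' + \<eta> * L g' = L s" unfolding fgs(3) L_def by simp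
    also have "L s = 0" unfolding s12 L_def by simp
    finally have L0: "\<phi> * L f' + \<eta> * L g' = 0" .
    have "L f' \<noteq> 0" using det3_nz[of f' b c] abV cV bc f'g'V dist' unfolding L_def by auto
    then have "0 < L f' \<or> 0 < L g'" using L0 fgs(1,2)
      by (smt (verit) mult_pos_neg zero_less_mult_iff)
    then obtain f g where fg: "{f, g} \<in> M" "f \<noteq> a" "g \<noteq> a" "f \<noteq> b" "f \<noteq> c" "f \<in> V" "g \<in> V" "f \<noteq> g"
        "s \<in> open_cone2 f g" "0 < L f"
    proof
      assume "0 < L f'"
      then show thesis using that[of f' g'] fg' dist' f'g'V f'a s(2) by auto
    next
      assume "0 < L g'"
      then show thesis using that[of g' f'] fg' dist' f'g'V f'a s(2)
        by (auto simp: insert_commute open_cone2_commute[of g' f'])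
    qed
    obtain i j k where f: "f = i *\<^sub>R a + j *\<^sub>R b + k *\<^sub>R c" using det3_coords[of a b c] D by (metis less_irrefl)
    have i: "0 < i" using fg(10) D unfolding f L_def by (simp add: zero_less_mult_iff)
    have f': "f = j *\<^sub>R b + i *\<^sub>R a + k *\<^sub>R c" using f by simp
    have a_notin: "x *\<^sub>R a \<notin> open_cone2 f g" for x using notin_cone[of a f g x] fg abV by auto
    from s12(3,1,2) f' i show False
    proof (cases rule: exit_side)
      case 1
      have "k \<noteq> 0"
      proof
        assume "k = 0"
        then have "det3 a b f = 0" unfolding f by simp
        then show False using det3_nz[of a b f] fg abV by auto
      qed
      moreover have "j \<noteq> 0"
      proof
        assume "j = 0"
        then have "det3 a c f = 0" unfolding f by simp
        then show False using det3_nz[of a c f] fg abV cV by auto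
      qed
      ultimately have "f \<in> open_cone3 a b c" using 1 i unfolding f by (auto intro!: open_cone3I)
      then show False using fg empty by blast
    next
      case (2 t x y)
      have in_fg: "s + t *\<^sub>R f \<in> open_cone2 f g" using fg(9) 2(1) by (rule open_cone2_add)
      then have "y \<noteq> 0" using a_notin[of x] 2(4) by auto
      then have "s + t *\<^sub>R f \<in> open_cone2 a c" using 2 by (auto intro!: open_cone2I)
      then show False using arcs_disjoint[OF fg(1) ac in_fg] fg by (auto simp: doubleton_eq_iff)
    next
      case (3 t x y)
      have in_fg: "s + t *\<^sub>R f \<in> open_cone2 f g" using fg(9) 3(1) by (rule open_cone2_add)
      have "s + t *\<^sub>R f \<in> open_cone2 b a" using 3 by (auto intro!: open_cone2I)
      then show False using arcs_disjoint[OF fg(1) ab in_fg] fg by (auto simp: doubleton_eq_iff open_cone2_commute)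
    qed
  qed
  then have "face a b c" unfolding face_def using ab ac empty by auto
  then show thesis using that D by blast
qed

lemma right_face_exists:
  assumes ab: "{a, b} \<in> M"
  obtains c where "face a b c" "det3 a b c < 0"
proof -
  obtain c where "face b a c" "0 < det3 b a c" using left_face_exists[of b a] ab by (auto simp: insert_commute)
  then show thesis using that[of c] face_swap12 det3_swap12[of a b c] by auto
qed

end

subsection \<open>Counting faces\<close>

text \<open>Finitely many planes through the origin do not cover space. In the induction
  \<open>z\<close> is moved in the direction of the new normal by an amount avoiding finitely many
  bad values.\<close>

lemma exists_nonorthogonal:
  fixes N :: "(real^3) set"
  assumes "finite N" "0 \<notin> N"
  obtains z where "\<And>n. n \<in> N \<Longrightarrow> z \<bullet> n \<noteq> 0"
proof -
  from assms have "\<exists>z. \<forall>n\<in>N. z \<bullet> n \<noteq> 0"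
  proof (induction N rule: finite_induct)
    case (insert m N)
    then obtain z where z: "\<forall>n\<in>N. z \<bullet> n \<noteq> 0" by auto
    define B where "B = (\<lambda>n. - (z \<bullet> n) / (m \<bullet> n)) ` (insert m N)"
    have "finite B" using insert by (simp add: B_def)
    then obtain \<tau> where \<tau>: "0 < \<tau>" "\<tau> \<notin> B"
      using infinite_Ioi[of "0::real"] finite_subset[of "{0<..}" B] by (auto simp: subset_iff)
    have "(z + \<tau> *\<^sub>R m) \<bullet> n \<noteq> 0" if n: "n \<in> insert m N" for n
    proof
      assume "(z + \<tau> *\<^sub>R m) \<bullet> n = 0"
      then have e: "z \<bullet> n + \<tau> * (m \<bullet> n) = 0" by (simp add: inner_add_left)
      show False
      proof (cases "m \<bullet> n = 0")
        case True
        then have "n \<noteq> m" using insert.prems by auto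
        then show False using z n e True by auto
      next
        case False
        then have "\<tau> = - (z \<bullet> n) / (m \<bullet> n)" using e by (simp add: field_simps)
        then show False using \<tau> n unfolding B_def by blast
      qed
    qed
    then show ?case by blast
  qed simp
  then show thesis using that by blast
qed

section \<open>Angular sectors at a vertex\<close>

context arc_triangulation
begin

text \<open>According to the sign of \<open>x\<close>, the end \<open>b'\<close> lies in the empty
  face, on the open arc \<open>b c\<close>, or beyond it, where \<open>v b'\<close> would cross
  \<open>b c\<close>.\<close>

lemma no_arc_in_sector:
  assumes f: "face v b c" and b': "{v, b'} \<in> M" "b' = x *\<^sub>R v + y *\<^sub>R b + z *\<^sub>R c" "0 < y" "0 < z"
  shows False
proof -
  note fD = faceD[OF f]
  have b'V: "b' \<in> V" "v \<noteq> b'" using arcD[OF b'(1)] by auto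
  have "det3 v b b' = z * det3 v b c" unfolding b'(2) by simp
  then have "det3 v b b' \<noteq> 0" using fD b'(4) by simp
  then have b'b: "b' \<noteq> b" by auto
  have "det3 v b' c = y * det3 v b c" unfolding b'(2) by simp
  then have "det3 v b' c \<noteq> 0" using fD b'(3) by simp
  then have b'c: "b' \<noteq> c" by auto
  consider "0 < x" | "x = 0" | "x < 0" by linarith
  then show False
  proof cases
    case 1
    then have "b' \<in> open_cone3 v b c" using b' by (auto intro: open_cone3I)
    then show False using f b'V unfolding face_def by blast
  next
    case 2
    then have "1 *\<^sub>R b' \<in> open_cone2 b c" using b' by (auto intro: open_cone2I)
    then show False using notin_cone[of b' b c 1] b'V b'b b'c fD by blast
  next
    case 3
    have "(- x) *\<^sub>R v + 1 *\<^sub>R b' \<in> open_cone2 v b'" using 3 by (intro open_cone2I) auto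
    moreover have "(- x) *\<^sub>R v + 1 *\<^sub>R b' = y *\<^sub>R b + z *\<^sub>R c" using b'(2) by simp
    moreover have "y *\<^sub>R b + z *\<^sub>R c \<in> open_cone2 b c" using b' by (intro open_cone2I) auto
    ultimately have "{v, b'} = {b, c}"
      using arcs_disjoint[OF b'(1), of b c] f unfolding face_def by metis
    then show False using fD by (auto simp: doubleton_eq_iff)
  qed
qed

text \<open>Projecting from \<open>v\<close> leaves two plane sectors with a common direction. No
  boundary ray of one may run inside the other, so they coincide. The assumption on
  \<open>y1\<close> fixes which of \<open>b'\<close>, \<open>c'\<close> belongs to
  \<open>b\<close>.\<close>

lemma sector_unique_aux:
  assumes f: "face v b c" and f': "face v b' c'"
    and b': "b' = x1 *\<^sub>R v + y1 *\<^sub>R b + z1 *\<^sub>R c" and c': "c' = x2 *\<^sub>R v + y2 *\<^sub>R b + z2 *\<^sub>R c"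
    and pos: "0 < \<beta>'" "0 < \<gamma>'" "0 < \<beta>' * y1 + \<gamma>' * y2" "0 < \<beta>' * z1 + \<gamma>' * z2"
    and y1: "0 < y1"
  shows "{b, c} = {b', c'}"
proof -
  note fD = faceD[OF f] and f'D = faceD[OF f']
  have z1: "z1 \<le> 0" using no_arc_in_sector[OF f, of b' x1 y1 z1] b' y1 f' unfolding face_def by force
  then have "\<beta>' * z1 \<le> 0" using pos by (simp add: mult_le_0_iff)
  then have z2: "0 < z2" using pos by (smt (verit) zero_less_mult_iff)
  have y2: "y2 \<le> 0" using no_arc_in_sector[OF f, of c' x2 y2 z2] c' z2 f' unfolding face_def by force
  \<comment> \<open>The determinant of \<open>b'\<close>, \<open>c'\<close> in the coordinates of
    \<open>b\<close>, \<open>c\<close> modulo \<open>v\<close>. Being positive, it lets the system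
    be inverted, and \<open>b\<close> or \<open>c\<close> would lie inside the second sector unless
    \<open>z1\<close> and \<open>y2\<close> vanish.\<close>
  define D where "D = y1 * z2 - z1 * y2"
  have "\<beta>' * \<gamma>' * D = (\<beta>' * y1 + \<gamma>' * y2) * (\<gamma>' * z2) - (\<beta>' * z1 + \<gamma>' * z2) * (\<gamma>' * y2)"
    unfolding D_def by (simp add: algebra_simps)
  moreover have "0 < (\<beta>' * y1 + \<gamma>' * y2) * (\<gamma>' * z2)" using pos z2 by simp
  moreover have "(\<beta>' * z1 + \<gamma>' * z2) * (\<gamma>' * y2) \<le> 0" using pos y2 by (simp add: mult_le_0_iff)
  ultimately have "0 < \<beta>' * \<gamma>' * D" by linarith
  then have D: "0 < D" using mult_pos_pos[OF pos(1,2)] by (simp add: zero_less_mult_iff)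
  have "D *\<^sub>R b = (z1 * x2 - z2 * x1) *\<^sub>R v + z2 *\<^sub>R b' + (- z1) *\<^sub>R c'"
    unfolding b' c' D_def by (simp add: algebra_simps)
  then have "(1 / D) *\<^sub>R (D *\<^sub>R b) = (1 / D) *\<^sub>R ((z1 * x2 - z2 * x1) *\<^sub>R v + z2 *\<^sub>R b' + (- z1) *\<^sub>R c')" by simp
  then have bexp: "b = ((z1 * x2 - z2 * x1) / D) *\<^sub>R v + (z2 / D) *\<^sub>R b' + (- z1 / D) *\<^sub>R c'"
    using D by (simp add: scaleR_add_right scaleR_diff_right)
  have "D *\<^sub>R c = (y2 * x1 - y1 * x2) *\<^sub>R v + (- y2) *\<^sub>R b' + y1 *\<^sub>R c'"
    unfolding b' c' D_def by (simp add: algebra_simps)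
  then have "(1 / D) *\<^sub>R (D *\<^sub>R c) = (1 / D) *\<^sub>R ((y2 * x1 - y1 * x2) *\<^sub>R v + (- y2) *\<^sub>R b' + y1 *\<^sub>R c')" by simp
  then have cexp: "c = ((y2 * x1 - y1 * x2) / D) *\<^sub>R v + (- y2 / D) *\<^sub>R b' + (y1 / D) *\<^sub>R c'"
    using D by (simp add: scaleR_add_right scaleR_diff_right)
  have arcs: "{v, b} \<in> M" "{v, c} \<in> M" using f unfolding face_def by auto
  have "\<not> z1 < 0"
  proof
    assume "z1 < 0"
    then show False using no_arc_in_sector[OF f' arcs(1) bexp] z2 D by (simp add: divide_neg_pos)
  qed
  then have "z1 = 0" using z1 by simp
  have "\<not> y2 < 0"
  proof
    assume "y2 < 0"
    then show False using no_arc_in_sector[OF f' arcs(2) cexp] y1 D by (simp add: divide_neg_pos)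
  qed
  then have "y2 = 0" using y2 by simp
  have "det3 v b b' = 0" unfolding b' \<open>z1 = 0\<close> by simp
  then have "b' = b" using det3_nz[of v b b'] fD f'D by auto
  have "det3 v c c' = 0" unfolding c' \<open>y2 = 0\<close> by simp
  then have "c' = c" using det3_nz[of v c c'] fD f'D by auto
  show ?thesis using \<open>b' = b\<close> \<open>c' = c\<close> by simp
qed

lemma sector_unique:
  assumes f: "face v b c" and f': "face v b' c'"
    and q: "q = \<alpha> *\<^sub>R v + \<beta> *\<^sub>R b + \<gamma> *\<^sub>R c" "0 < \<beta>" "0 < \<gamma>"
    and q': "q = \<alpha>' *\<^sub>R v + \<beta>' *\<^sub>R b' + \<gamma>' *\<^sub>R c'" "0 < \<beta>'" "0 < \<gamma>'"
  shows "{b, c} = {b', c'}"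
proof -
  have D: "det3 v b c \<noteq> 0" using faceD[OF f] by simp
  obtain x1 y1 z1 where b': "b' = x1 *\<^sub>R v + y1 *\<^sub>R b + z1 *\<^sub>R c" using det3_coords[OF D] .
  obtain x2 y2 z2 where c': "c' = x2 *\<^sub>R v + y2 *\<^sub>R b + z2 *\<^sub>R c" using det3_coords[OF D] .
  have "det3 v q c = \<beta> * det3 v b c" unfolding q by simp
  moreover have "det3 v q c = (\<beta>' * y1 + \<gamma>' * y2) * det3 v b c" unfolding q' b' c' by (simp add: algebra_simps)
  ultimately have \<beta>: "\<beta>' * y1 + \<gamma>' * y2 = \<beta>" using D by simp
  have "det3 v b q = \<gamma> * det3 v b c" unfolding q by simp
  moreover have "det3 v b q = (\<beta>' * z1 + \<gamma>' * z2) * det3 v b c" unfolding q' b' c' by (simp add: algebra_simps)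
  ultimately have \<gamma>: "\<beta>' * z1 + \<gamma>' * z2 = \<gamma>" using D by simp
  consider "0 < y1" | "0 < z1" | "y1 \<le> 0" "z1 \<le> 0" by linarith
  then show ?thesis
  proof cases
    case 1
    then show ?thesis using sector_unique_aux[OF f f' b' c' q'(2,3)] q \<beta> \<gamma> by simp
  next
    case 2
    have "{c, b} = {b', c'}"
      using sector_unique_aux[OF face_swap23[OF f] f', of x1 z1 y1 x2 z2 y2 \<beta>' \<gamma>'] 2 q q' \<beta> \<gamma> b' c'
      by (simp add: ac_simps)
    then show ?thesis by (simp add: insert_commute)
  next
    case 3
    have "\<beta>' * y1 \<le> 0" "\<beta>' * z1 \<le> 0" using 3 q' by (auto simp: mult_le_0_iff)
    then have "0 < \<gamma>' * y2" "0 < \<gamma>' * z2" using \<beta> \<gamma> q by linarith+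
    then have "0 < y2" "0 < z2" using q' by (auto simp: zero_less_mult_iff)
    then show ?thesis using no_arc_in_sector[OF f, of c' x2 y2 z2] c' f' unfolding face_def by blast
  qed
qed

text \<open>Walk towards \<open>z\<close> from a point of an arc; the face entered after the last crossed arc contains \<open>z\<close>.\<close>

lemma faces_cover:
  assumes ab: "{a, b} \<in> M"
    and gen: "\<And>u v. u \<in> V \<Longrightarrow> v \<in> V \<Longrightarrow> u \<noteq> v \<Longrightarrow> det3 u v z \<noteq> 0"
  obtains c d e where "face c d e" "z \<in> open_cone3 c d e"
proof -
  have abV: "a \<in> V" "b \<in> V" "a \<noteq> b" using arcD[OF ab] .
  have gen': "det3 u z v \<noteq> 0" "det3 z u v \<noteq> 0" if "u \<in> V" "v \<in> V" "u \<noteq> v" for u v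
    using gen[OF that] det3_swap23[of u v z] det3_rotate[of u v z] by auto
  \<comment> \<open>The start on the arc \<open>a b\<close> is chosen so that the great circle
    through it and \<open>z\<close> contains no vertex.\<close>
  obtain \<tau> where \<tau>: "0 < \<tau>" "\<tau> \<notin> (\<lambda>v. - det3 a z v / det3 b z v) ` V"
    using infinite_Ioi[of "0::real"] finite_subset[of "{0<..}" "(\<lambda>v. - det3 a z v / det3 b z v) ` V"] finite_V
    by (auto simp: subset_iff)
  define s where "s = a + \<tau> *\<^sub>R b"
  have s_gen: "det3 s z v \<noteq> 0" if v: "v \<in> V" for v
  proof
    assume 0: "det3 s z v = 0"
    show False
    proof (cases "v = b")
      case True
      then show False using 0 gen'(1)[of a b] abV by (simp add: s_def)
    next
      case False
      then have "\<tau> = - det3 a z v / det3 b z v" using 0 gen'(1)[of b v] abV v by (simp add: s_def field_simps)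
      then show False using \<tau> v by blast
    qed
  qed
  \<comment> \<open>As t grows, \<open>s + t *\<^sub>R z\<close> moves from \<open>s\<close> towards
    the direction of \<open>z\<close>. The start t = 0 counts as a crossing of \<open>a b\<close>,
    so a last crossing exists.\<close>
  define K where "K = {t. 0 \<le> t \<and> (\<exists>c d. {c, d} \<in> M \<and> s + t *\<^sub>R z \<in> open_cone2 c d)}"
  have "s + 0 *\<^sub>R z \<in> open_cone2 a b" using open_cone2I[of 1 \<tau> a b] \<tau> by (simp add: s_def)
  then have "0 \<in> K" unfolding K_def using ab by blast
  have "K \<subseteq> (\<lambda>(c, d). - det3 s c d / det3 z c d) ` (V \<times> V)"
  proof
    fix t assume "t \<in> K"
    then obtain c d where cd: "{c, d} \<in> M" "s + t *\<^sub>R z \<in> open_cone2 c d" unfolding K_def by blast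
    obtain \<gamma> \<delta> where **: "s + t *\<^sub>R z = \<gamma> *\<^sub>R c + \<delta> *\<^sub>R d" using cd(2) by (rule open_cone2E)
    have "det3 (s + t *\<^sub>R z) c d = 0" unfolding ** by simp
    then have "det3 s c d + t * det3 z c d = 0" by simp
    moreover have "det3 z c d \<noteq> 0" using gen'(2) arcD[OF cd(1)] by auto
    ultimately have "t = - det3 s c d / det3 z c d" by (simp add: field_simps)
    then show "t \<in> (\<lambda>(c, d). - det3 s c d / det3 z c d) ` (V \<times> V)" using arcD[OF cd(1)] by auto
  qed
  then have fin: "finite K" by (rule finite_subset) (simp add: finite_V)
  define t1 where "t1 = Max K"
  have "t1 \<in> K" using Max_in[OF fin] \<open>0 \<in> K\<close> by (auto simp: t1_def)
  have t1_max: "t \<le> t1" if "t \<in> K" for t using fin that by (simp add: t1_def)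
  obtain c d where cd: "0 \<le> t1" "{c, d} \<in> M" "s + t1 *\<^sub>R z \<in> open_cone2 c d" using \<open>t1 \<in> K\<close> unfolding K_def by blast
  have cdV: "c \<in> V" "d \<in> V" "c \<noteq> d" using arcD[OF cd(2)] .
  obtain e where e: "face c d e" "0 < det3 c d e * det3 c d z"
  proof (cases "0 < det3 c d z")
    case True
    then show thesis using left_face_exists[OF cd(2)] that by (metis mult_pos_pos)
  next
    case False
    then have "det3 c d z < 0" using gen cdV by force
    then show thesis using right_face_exists[OF cd(2)] that by (metis mult_neg_neg)
  qed
  note eD = faceD[OF e(1)]
  have "det3 c e d \<noteq> 0" using eD(7) det3_swap23[of c d e] by simp
  then obtain i j k where z: "z = i *\<^sub>R c + j *\<^sub>R e + k *\<^sub>R d" by (rule det3_coords)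
  have "det3 c d z = j * det3 c d e" unfolding z by simp
  then have "0 < j * (det3 c d e)\<^sup>2" using e(2) by (simp add: power2_eq_square ac_simps)
  then have j: "0 < j" by (simp add: zero_less_mult_iff)
  obtain s1 s2 where s12: "0 < s1" "0 < s2" "s + t1 *\<^sub>R z = s1 *\<^sub>R c + s2 *\<^sub>R d" using cd(3) by (rule open_cone2E)
  \<comment> \<open>Meeting a side later contradicts the choice of \<open>t1\<close>, and meeting it
    at a vertex (y = 0) the choice of \<open>s\<close>. So the walk ends inside the face.\<close>
  have no_more: False if "0 < t" "{f, g} \<in> M" "0 < x" "0 \<le> y" "s + t1 *\<^sub>R z + t *\<^sub>R z = x *\<^sub>R f + y *\<^sub>R g" for t f g x y
  proof (cases "y = 0")
    case True
    then have sz: "s + (t1 + t) *\<^sub>R z = x *\<^sub>R f" using that by (simp add: algebra_simps)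
    have "det3 (s + (t1 + t) *\<^sub>R z) z f = 0" unfolding sz by simp
    then show False using s_gen[of f] arcD[OF that(2)] by simp
  next
    case False
    then have "s + (t1 + t) *\<^sub>R z \<in> open_cone2 f g" using that open_cone2I[of x y f g] by (simp add: algebra_simps)
    then have "t1 + t \<in> K" unfolding K_def using that cd(1) by auto
    then show False using t1_max[of "t1 + t"] that by simp
  qed
  have arcs': "{e, d} \<in> M" "{c, e} \<in> M" using e(1) unfolding face_def by (auto simp: insert_commute)
  from s12(3,1,2) z j show thesis
  proof (cases rule: exit_side)
    case 1
    have "i \<noteq> 0"
    proof
      assume "i = 0"
      then have "det3 e d z = 0" unfolding z by simp
      then show False using gen eD by auto
    qed
    moreover have "k \<noteq> 0"
    proof
      assume "k = 0"
      then have "det3 c e z = 0" unfolding z by simp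
      then show False using gen eD by auto
    qed
    ultimately have "z \<in> open_cone3 c e d" using 1 j z by (auto intro: open_cone3I)
    then show thesis using that face_swap23[OF e(1)] by blast
  next
    case (2 t x y)
    then show thesis using no_more[OF 2(1) arcs'(1) 2(2,3)] by blast
  next
    case (3 t x y)
    then show thesis using no_more[OF 3(1) arcs'(2) 3(2), of y] by simp
  qed
qed

definition faces :: "(real^3) set set" where
  "faces = {{a, b, c} | a b c. face a b c}"

lemma finite_faces: "finite faces"
proof -
  have "faces \<subseteq> Pow V" unfolding faces_def using faceD by auto
  then show ?thesis using finite_V finite_subset by blast
qed

text \<open>The sign of \<alpha> is free: what counts is that the direction from \<open>v\<close>
  towards \<open>z\<close> points into the face, not that \<open>z\<close> lies in it.\<close>

definition sector :: "real^3 \<Rightarrow> real^3 \<Rightarrow> (real^3) set \<Rightarrow> bool" where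
  "sector z v T \<longleftrightarrow> (\<exists>b c \<alpha> \<beta> \<gamma>. T = {v, b, c} \<and> face v b c \<and> 0 < \<beta> \<and> 0 < \<gamma> \<and>
     z = \<alpha> *\<^sub>R v + \<beta> *\<^sub>R b + \<gamma> *\<^sub>R c)"

lemma sectorI:
  "face v b c \<Longrightarrow> 0 < \<beta> \<Longrightarrow> 0 < \<gamma> \<Longrightarrow> z = \<alpha> *\<^sub>R v + \<beta> *\<^sub>R b + \<gamma> *\<^sub>R c \<Longrightarrow> sector z v {v, b, c}"
  unfolding sector_def by blast

lemma sectors_of_interior:
  assumes "face a b c" "z \<in> open_cone3 a b c"
  shows "sector z a {a, b, c}" "sector z b {a, b, c}" "sector z c {a, b, c}"
proof -
  obtain \<alpha> \<beta> \<gamma> where z: "0 < \<alpha>" "0 < \<beta>" "0 < \<gamma>" "z = \<alpha> *\<^sub>R a + \<beta> *\<^sub>R b + \<gamma> *\<^sub>R c"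
    using assms(2) by (auto simp: open_cone3_def)
  show "sector z a {a, b, c}" using sectorI[OF assms(1)] z by blast
  have "sector z b {b, a, c}"
    using sectorI[OF face_swap12[OF assms(1)], of \<alpha> \<gamma> z \<beta>] z by (simp add: ac_simps)
  then show "sector z b {a, b, c}" by (simp add: insert_commute)
  have "sector z c {c, a, b}"
    using sectorI[OF face_swap12[OF face_swap23[OF assms(1)]], of \<alpha> \<beta> z \<gamma>] z by (simp add: ac_simps)
  then show "sector z c {a, b, c}" by (simp add: insert_commute)
qed

lemma sector_of_same_sign:
  assumes f: "face v p q" and "0 < j * k" and z: "z = i *\<^sub>R v + j *\<^sub>R p + k *\<^sub>R q"
  shows "\<exists>\<sigma>\<in>{1, -1::real}. sector (\<sigma> *\<^sub>R z) v {v, p, q}"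
proof -
  have "0 < j \<and> 0 < k \<or> 0 < - j \<and> 0 < - k" using assms(2) by (auto simp: zero_less_mult_iff)
  then show ?thesis
  proof
    assume "0 < j \<and> 0 < k"
    then have "sector (1 *\<^sub>R z) v {v, p, q}" using sectorI[OF f, of j k "1 *\<^sub>R z" i] z by simp
    then show ?thesis by blast
  next
    assume "0 < - j \<and> 0 < - k"
    then have "sector (- 1 *\<^sub>R z) v {v, p, q}"
      using sectorI[OF f, of "- j" "- k" "- 1 *\<^sub>R z" "- i"] z by simp
    then show ?thesis by blast
  qed
qed

text \<open>Two of the three nonzero coordinates of \<open>z\<close> have the same sign. At the
  remaining corner the direction to \<open>z\<close> or to \<open>- z\<close> points into the
  face.\<close>

lemma exists_sector:
  assumes f: "face a b c"
    and gen: "\<And>u v. u \<in> V \<Longrightarrow> v \<in> V \<Longrightarrow> u \<noteq> v \<Longrightarrow> det3 u v z \<noteq> 0"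
  shows "\<exists>v\<in>V. \<exists>\<sigma>\<in>{1, -1::real}. sector (\<sigma> *\<^sub>R z) v {a, b, c}"
proof -
  note fD = faceD[OF f]
  obtain \<alpha> \<beta> \<gamma> where z: "z = \<alpha> *\<^sub>R a + \<beta> *\<^sub>R b + \<gamma> *\<^sub>R c" using det3_coords[OF fD(7)] .
  have "\<alpha> \<noteq> 0" using gen[OF fD(2,3,5)] unfolding z by auto
  moreover have "\<beta> \<noteq> 0" using gen[OF fD(1,3,6)] unfolding z by auto
  moreover have "\<gamma> \<noteq> 0" using gen[OF fD(1,2,4)] unfolding z by auto
  ultimately consider "0 < \<beta> * \<gamma>" | "0 < \<alpha> * \<gamma>" | "0 < \<alpha> * \<beta>"
    by (fastforce simp: zero_less_mult_iff)
  then show ?thesis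
  proof cases
    case 1
    then show ?thesis using sector_of_same_sign[OF f _ z] fD by blast
  next
    case 2
    have "\<exists>\<sigma>\<in>{1, -1::real}. sector (\<sigma> *\<^sub>R z) b {b, a, c}"
      using sector_of_same_sign[OF face_swap12[OF f] 2, of z \<beta>] z by (simp add: ac_simps)
    moreover have "{b, a, c} = {a, b, c}" by auto
    ultimately show ?thesis using fD(2) by auto
  next
    case 3
    have "\<exists>\<sigma>\<in>{1, -1::real}. sector (\<sigma> *\<^sub>R z) c {c, a, b}"
      using sector_of_same_sign[OF face_swap12[OF face_swap23[OF f]] 3, of z \<gamma>] z by (simp add: ac_simps)
    moreover have "{c, a, b} = {a, b, c}" by auto
    ultimately show ?thesis using fD(3) by auto
  qed
qed

lemma sector_inj:
  assumes "sector z v T" "sector z v T'"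
  shows "T = T'"
proof -
  obtain b c \<alpha> \<beta> \<gamma> where 1: "T = {v, b, c}" "face v b c" "0 < \<beta>" "0 < \<gamma>"
      "z = \<alpha> *\<^sub>R v + \<beta> *\<^sub>R b + \<gamma> *\<^sub>R c" using assms(1) unfolding sector_def by blast
  obtain b' c' \<alpha>' \<beta>' \<gamma>' where 2: "T' = {v, b', c'}" "face v b' c'" "0 < \<beta>'" "0 < \<gamma>'"
      "z = \<alpha>' *\<^sub>R v + \<beta>' *\<^sub>R b' + \<gamma>' *\<^sub>R c'" using assms(2) unfolding sector_def by blast
  have "{b, c} = {b', c'}" by (rule sector_unique[OF 1(2) 2(2) 1(5,3,4) 2(5,3,4)])
  then show ?thesis using 1 2 by simp
qed

text \<open>Fix a generic axis through \<open>z\<close> and \<open>-z\<close>. At each vertex the meridian directions towards \<open>z\<close> and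
  \<open>-z\<close> lie in at most one face each, while a face receives one such direction, at its vertex of
  intermediate longitude, or three if it contains a pole.\<close>

lemma card_faces:
  assumes ab: "{a, b} \<in> M"
  shows "card faces + 4 \<le> 2 * card V"
proof -
  \<comment> \<open>Normals of the great circles through two vertices; the axis is chosen off all of
    these circles.\<close>
  define N where "N = {cross3 u v | u v. u \<in> V \<and> v \<in> V \<and> u \<noteq> v}"
  have "N \<subseteq> (\<lambda>(u, v). cross3 u v) ` (V \<times> V)" unfolding N_def by auto
  then have "finite N" by (rule finite_subset) (simp add: finite_V)
  moreover have "0 \<notin> N"
  proof
    assume "0 \<in> N"
    then obtain u v where uv: "u \<in> V" "v \<in> V" "u \<noteq> v" "cross3 u v = 0" unfolding N_def by auto
    obtain c where "0 < det3 u v c" using exists_left_vertex[OF uv(1-3)] by blast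
    then show False using uv by (simp add: det3_inner)
  qed
  ultimately obtain z where z: "\<And>n. n \<in> N \<Longrightarrow> z \<bullet> n \<noteq> 0" using exists_nonorthogonal by blast
  have gen: "det3 u v z \<noteq> 0" if "u \<in> V" "v \<in> V" "u \<noteq> v" for u v
    using z[of "cross3 u v"] that unfolding N_def det3_inner by blast
  define inc where "inc T = {(v, \<sigma>). v \<in> V \<and> \<sigma> \<in> {1, -1::real} \<and> sector (\<sigma> *\<^sub>R z) v T}" for T
  have inc_sub: "inc T \<subseteq> V \<times> {1, -1}" for T unfolding inc_def by auto
  have fin_inc: "finite (inc T)" for T using inc_sub finite_subset[of "inc T"] finite_V by blast
  have "(\<Sum>T\<in>faces. card (inc T)) = card (\<Union>T\<in>faces. inc T)"
  proof (rule card_UN_disjoint[symmetric])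
    show "\<forall>T\<in>faces. \<forall>T'\<in>faces. T \<noteq> T' \<longrightarrow> inc T \<inter> inc T' = {}"
      unfolding inc_def using sector_inj by blast
  qed (auto simp: finite_faces fin_inc)
  also have "\<dots> \<le> card (V \<times> {1, -1::real})"
    by (rule card_mono) (use inc_sub finite_V in auto)
  also have "\<dots> = 2 * card V" by (simp add: card_cartesian_product)
  finally have upper: "(\<Sum>T\<in>faces. card (inc T)) \<le> 2 * card V" .
  have one: "1 \<le> card (inc T)" if T: "T \<in> faces" for T
  proof -
    obtain c d e where "T = {c, d, e}" "face c d e" using T unfolding faces_def by blast
    then have "inc T \<noteq> {}" using exists_sector[OF _ gen] unfolding inc_def by blast
    then show ?thesis using fin_inc[of T] by (simp add: Suc_le_eq card_gt_0_iff)
  qed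
  have pole: "\<exists>T\<in>faces. \<exists>S. card S = 3 \<and> S \<times> {\<sigma>} \<subseteq> inc T" if \<sigma>: "\<sigma> \<in> {1, -1::real}" for \<sigma>
  proof -
    have "det3 u v (\<sigma> *\<^sub>R z) \<noteq> 0" if "u \<in> V" "v \<in> V" "u \<noteq> v" for u v using gen[OF that] \<sigma> by auto
    then obtain c d e where f: "face c d e" "\<sigma> *\<^sub>R z \<in> open_cone3 c d e" using faces_cover[OF ab] by blast
    have "{c, d, e} \<times> {\<sigma>} \<subseteq> inc {c, d, e}"
      unfolding inc_def using sectors_of_interior[OF f] \<sigma> faceD(1-3)[OF f(1)] by auto
    moreover have "card {c, d, e} = 3" using faceD[OF f(1)] by simp
    ultimately show ?thesis using f(1) unfolding faces_def by blast
  qed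
  obtain T S where T: "T \<in> faces" "card S = 3" "S \<times> {1} \<subseteq> inc T" using pole[of 1] by auto
  obtain T' S' where T': "T' \<in> faces" "card S' = 3" "S' \<times> {-1} \<subseteq> inc T'" using pole[of "-1"] by auto
  \<comment> \<open>Every face has at least one incidence, and one around a pole has three for that
    pole. The surplus is two per pole, and incidences for different poles are distinct even within
    one face.\<close>
  have "card faces + 4 \<le> (\<Sum>T\<in>faces. card (inc T))"
  proof (cases "T = T'")
    case True
    have "S \<times> {1} \<union> S' \<times> {-1} \<subseteq> inc T" using T T' True by blast
    then have "card (S \<times> {1} \<union> S' \<times> {-1::real}) \<le> card (inc T)" using card_mono fin_inc by blast
    moreover have "card (S \<times> {1} \<union> S' \<times> {-1::real}) = card (S \<times> {1::real}) + card (S' \<times> {-1::real})"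
      using T(2) T'(2) card_ge_0_finite[of S] card_ge_0_finite[of S'] by (intro card_Un_disjoint) auto
    ultimately have "6 \<le> card (inc T)" using T T' by (simp add: card_cartesian_product)
    moreover have "(\<Sum>T\<in>faces - {T}. 1) \<le> (\<Sum>T\<in>faces - {T}. card (inc T))"
      using one by (intro sum_mono) auto
    moreover have "card faces = Suc (card (faces - {T}))" using T finite_faces by (metis card_Suc_Diff1)
    ultimately show ?thesis using sum.remove[OF finite_faces T(1), of "\<lambda>T. card (inc T)"] by simp
  next
    case False
    have "card (S \<times> {1::real}) \<le> card (inc T)" using T(3) card_mono fin_inc by blast
    then have c1: "3 \<le> card (inc T)" using T by (simp add: card_cartesian_product)
    have "card (S' \<times> {-1::real}) \<le> card (inc T')" using T'(3) card_mono fin_inc by blast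
    then have c2: "3 \<le> card (inc T')" using T' by (simp add: card_cartesian_product)
    have T'_in: "T' \<in> faces - {T}" using T' False by auto
    have "(\<Sum>T\<in>faces - {T} - {T'}. 1) \<le> (\<Sum>T\<in>faces - {T} - {T'}. card (inc T))"
      using one by (intro sum_mono) auto
    moreover have "card faces = Suc (Suc (card (faces - {T} - {T'})))"
      using T T'_in finite_faces by (metis card_Suc_Diff1 finite_Diff)
    ultimately show ?thesis
      using sum.remove[OF finite_faces T(1), of "\<lambda>T. card (inc T)"]
        sum.remove[OF _ T'_in, of "\<lambda>T. card (inc T)"] finite_faces c1 c2 by simp
  qed
  then show ?thesis using upper by linarith
qed

end

section \<open>Extending a noncrossing family to a triangulation\<close>

lemma noncrossingD:
  "noncrossing M \<Longrightarrow> {a, b} \<in> M \<Longrightarrow> {c, d} \<in> M \<Longrightarrow> {a, b} \<noteq> {c, d} \<Longrightarrow> open_cone2 a b \<inter> open_cone2 c d = {}"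
  unfolding noncrossing_def by blast

lemma noncrossing_mono: "noncrossing M \<Longrightarrow> M' \<subseteq> M \<Longrightarrow> noncrossing M'"
  unfolding noncrossing_def by blast

lemma doubleton_cone_eq: "{a, b} = {c, d} \<Longrightarrow> open_cone2 a b = open_cone2 c d"
  by (auto simp: doubleton_eq_iff open_cone2_commute)

lemma noncrossing_insert:
  assumes M: "noncrossing M"
    and ab: "\<And>c d. {c, d} \<in> M \<Longrightarrow> {c, d} \<noteq> {a, b} \<Longrightarrow> open_cone2 a b \<inter> open_cone2 c d = {}"
  shows "noncrossing (insert {a, b} M)"
  unfolding noncrossing_def
proof (intro allI impI)
  fix c d e f
  assume cd: "{c, d} \<in> insert {a, b} M" and ef: "{e, f} \<in> insert {a, b} M" and ne: "{c, d} \<noteq> {e, f}"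
  show "open_cone2 c d \<inter> open_cone2 e f = {}"
  proof (cases "{c, d} = {a, b}")
    case True
    then have "{e, f} \<in> M" "{e, f} \<noteq> {a, b}" using ef ne by auto
    then show ?thesis using ab doubleton_cone_eq[OF True] by simp
  next
    case False
    then have cd': "{c, d} \<in> M" using cd by blast
    show ?thesis
    proof (cases "{e, f} = {a, b}")
      case True
      then show ?thesis using ab[OF cd' False] doubleton_cone_eq[OF True] by auto
    next
      case False
      then show ?thesis using ef cd' ne M noncrossingD by blast
    qed
  qed
qed

lemma exists_arc_triangulation:
  assumes V: "finite V" "generic_set V" "balanced_set V" "3 \<le> card V"
    and M0: "M0 \<subseteq> {{a, b} | a b. a \<in> V \<and> b \<in> V \<and> a \<noteq> b}" "noncrossing M0"
  obtains M where "M0 \<subseteq> M" "arc_triangulation V M"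
proof -
  define P where "P = {{a, b} | a b. a \<in> V \<and> b \<in> V \<and> a \<noteq> b}"
  define \<A> where "\<A> = {M. M \<subseteq> P \<and> noncrossing M}"
  have "P \<subseteq> Pow V" unfolding P_def by auto
  then have "finite P" using V(1) finite_subset by blast
  then have "finite \<A>" unfolding \<A>_def by simp
  moreover have "M0 \<in> \<A>" unfolding \<A>_def P_def using M0 by simp
  ultimately obtain M where M: "M \<in> \<A>" "M0 \<subseteq> M" and max: "\<And>M'. M' \<in> \<A> \<Longrightarrow> M \<subseteq> M' \<Longrightarrow> M = M'"
    using finite_has_maximal2[of \<A> M0] by metis
  have "arc_triangulation V M"
  proof
    fix a b assume ab: "a \<in> V" "b \<in> V" "a \<noteq> b"
      and unc: "\<And>c d. {c, d} \<in> M \<Longrightarrow> {c, d} \<noteq> {a, b} \<Longrightarrow> open_cone2 a b \<inter> open_cone2 c d = {}"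
    have "noncrossing (insert {a, b} M)"
      using M(1) unc unfolding \<A>_def by (intro noncrossing_insert) auto
    moreover have "insert {a, b} M \<subseteq> P" using M(1) ab unfolding \<A>_def P_def by auto
    ultimately have "M = insert {a, b} M" by (intro max) (auto simp: \<A>_def)
    then show "{a, b} \<in> M" by blast
  qed (use V M in \<open>auto simp: \<A>_def P_def\<close>)
  then show thesis using that M by blast
qed

section \<open>Ears of a triangulated polygon\<close>

lemma mod_shift_neq:
  fixes i n :: nat
  assumes "i < n" "a < n" "b < n" "a \<noteq> b"
  shows "(i + a) mod n \<noteq> (i + b) mod n"
  using assms by (auto simp: mod_if)

context arc_triangulation
begin

text \<open>Each of the \<open>n\<close> polygon edges lies on two faces, and a face carrying two polygon edges consists
  of three consecutive vertices; there are at most \<open>2 n - 4\<close> faces.\<close>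

lemma card_ears:
  fixes u :: "nat \<Rightarrow> real^3"
  assumes n: "4 \<le> n" and inj: "inj_on u {..<n}" and V: "V = u ` {..<n}"
    and edges: "\<And>i. i < n \<Longrightarrow> {u i, u (Suc i mod n)} \<in> M"
  shows "4 \<le> card {k. k < n \<and> {u k, u (Suc k mod n), u ((k + 2) mod n)} \<in> faces}"
proof -
  define q where "q i = {u i, u (Suc i mod n)}" for i
  define ear where "ear k = {u k, u (Suc k mod n), u ((k + 2) mod n)}" for k
  define I where "I T = {i. i < n \<and> q i \<subseteq> T}" for T
  have u_eq: "u i = u j \<longleftrightarrow> i = j" if "i < n" "j < n" for i j
    using inj_on_eq_iff[OF inj] that by auto
  have two: "2 \<le> card {T \<in> faces. q i \<subseteq> T}" if i: "i < n" for i
  proof -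
    define a b where "a = u i" and "b = u (Suc i mod n)"
    have ab: "{a, b} \<in> M" using edges[OF i] by (simp add: a_def b_def)
    obtain c where c: "face a b c" "0 < det3 a b c" using left_face_exists[OF ab] .
    obtain d where d: "face a b d" "det3 a b d < 0" using right_face_exists[OF ab] .
    have "c \<noteq> d" "c \<noteq> a" "c \<noteq> b" using c d by auto
    then have "{a, b, c} \<noteq> {a, b, d}" by auto
    moreover have "{{a, b, c}, {a, b, d}} \<subseteq> {T \<in> faces. q i \<subseteq> T}"
      using c d unfolding faces_def q_def a_def b_def by auto
    ultimately show ?thesis
      using card_mono[of "{T \<in> faces. q i \<subseteq> T}" "{{a, b, c}, {a, b, d}}"] finite_faces by simp
  qed
  have face_card: "card T = 3" "T \<subseteq> V" if "T \<in> faces" for T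
    using that faceD unfolding faces_def by auto
  have I_bound: "card (I T) \<le> 1 + of_bool (T \<in> ear ` {..<n})" if T: "T \<in> faces" for T
  proof -
    define J where "J = {i. i < n \<and> u i \<in> T}"
    have uJ: "u ` J = T" using face_card(2)[OF T] unfolding J_def V by auto
    have injJ: "inj_on u J" using inj unfolding J_def by (rule inj_on_subset) auto
    then have cJ: "card J = 3" using face_card(1)[OF T] card_image[OF injJ] uJ by simp
    have finJ: "finite J" unfolding J_def by simp
    have IJ: "I T \<subseteq> J" unfolding I_def J_def q_def by auto
    have sucJ: "Suc i mod n \<in> J" if "i \<in> I T" for i using that n unfolding I_def J_def q_def by auto
    show ?thesis
    proof (cases "card (I T) \<le> 1")
      case False
      then obtain i j where ij: "i \<in> I T" "j \<in> I T" "i \<noteq> j"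
        using card_le_Suc0_iff_eq[of "I T"] finite_subset[OF IJ finJ] by auto
      have three: "J = {k, Suc k mod n, (k + 2) mod n}" if k: "k \<in> I T" "Suc k mod n \<in> I T" for k
      proof -
        have kn: "k < n" using k unfolding I_def by simp
        have "(k + 2) mod n \<in> J" using sucJ[OF k(2)] by (simp add: mod_Suc_eq)
        then have sub: "{k, Suc k mod n, (k + 2) mod n} \<subseteq> J" using IJ k by auto
        have "card {k, Suc k mod n, (k + 2) mod n} = 3"
          using mod_shift_neq[of k n 0 1] mod_shift_neq[of k n 0 2] mod_shift_neq[of k n 1 2] kn n by simp
        then show ?thesis using card_subset_eq[OF finJ sub] cJ by simp
      qed
      \<comment> \<open>Two polygon edges without a common vertex would give the triangle four
        corners.\<close>
      have "\<exists>k. k \<in> I T \<and> Suc k mod n \<in> I T"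
      proof (rule ccontr)
        assume no: "\<nexists>k. k \<in> I T \<and> Suc k mod n \<in> I T"
        then have no': "Suc k mod n \<notin> I T" if "k \<in> I T" for k using that by blast
        have in_n: "i < n" "j < n" using ij unfolding I_def by auto
        have "Suc i mod n \<noteq> Suc j mod n" using ij(3) in_n n by (auto simp: mod_if split: if_splits)
        moreover have "Suc i mod n \<noteq> i" "Suc i mod n \<noteq> j" "Suc j mod n \<noteq> i" "Suc j mod n \<noteq> j"
          using no'[OF ij(1)] no'[OF ij(2)] ij by auto
        ultimately have "card {i, j, Suc i mod n, Suc j mod n} = 4" using ij(3) by simp
        moreover have "{i, j, Suc i mod n, Suc j mod n} \<subseteq> J" using IJ ij sucJ by auto
        then have "card {i, j, Suc i mod n, Suc j mod n} \<le> card J" by (rule card_mono[OF finJ])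
        ultimately show False using cJ by simp
      qed
      then obtain k where k: "k \<in> I T" "Suc k mod n \<in> I T" by blast
      have kn: "k < n" using k unfolding I_def by simp
      note J = three[OF k]
      have "T = ear k" using uJ unfolding J ear_def by auto
      then have "T \<in> ear ` {..<n}" using kn by auto
      \<comment> \<open>A third edge would lead to the vertex k + 3, which for n \<ge> 4 is a fourth
        corner.\<close>
      moreover have "(k + 2) mod n \<notin> I T"
      proof
        assume "(k + 2) mod n \<in> I T"
        then have "Suc ((k + 2) mod n) mod n \<in> J" by (rule sucJ)
        then have "(k + 3) mod n \<in> J" by (simp add: mod_Suc_eq numeral_3_eq_3)
        then show False unfolding J
          using mod_shift_neq[of k n 3 0] mod_shift_neq[of k n 3 1] mod_shift_neq[of k n 3 2] kn n by simp
      qed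
      then have "I T \<subseteq> {k, Suc k mod n}" using IJ J by auto
      then have "card (I T) \<le> 2" using card_mono[of "{k, Suc k mod n}" "I T"] card_insert_le_m1[of 2 "{Suc k mod n}" k] by auto
      ultimately show ?thesis by simp
    qed simp
  qed
  \<comment> \<open>Incidences of polygon edges with faces, counted both ways: 2 n is at most the
    number of faces plus the number of faces that are ears.\<close>
  have "2 * n = (\<Sum>i<n. 2)" by simp
  also have "\<dots> \<le> (\<Sum>i<n. card {T \<in> faces. q i \<subseteq> T})" using two by (intro sum_mono) simp
  also have "\<dots> = (\<Sum>i<n. \<Sum>T\<in>faces. of_bool (q i \<subseteq> T))"
    using finite_faces by (simp add: sum.If_cases Int_def of_bool_def)
  also have "\<dots> = (\<Sum>T\<in>faces. \<Sum>i<n. of_bool (q i \<subseteq> T))" by (rule sum.swap)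
  also have "\<dots> = (\<Sum>T\<in>faces. card (I T))"
    by (simp add: sum.If_cases Int_def of_bool_def I_def)
  also have "\<dots> \<le> (\<Sum>T\<in>faces. 1 + of_bool (T \<in> ear ` {..<n}))" using I_bound by (rule sum_mono)
  also have "\<dots> = card faces + card (faces \<inter> ear ` {..<n})"
    using finite_faces by (subst sum.distrib) (simp add: sum.If_cases Int_def of_bool_def)
  finally have "2 * n \<le> card faces + card (faces \<inter> ear ` {..<n})" .
  moreover have "card faces + 4 \<le> 2 * n"
    using card_faces[OF edges[of 0]] n card_image[OF inj] unfolding V by simp
  moreover have "faces \<inter> ear ` {..<n} \<subseteq> ear ` {k. k < n \<and> ear k \<in> faces}" by auto
  then have "card (faces \<inter> ear ` {..<n}) \<le> card {k. k < n \<and> ear k \<in> faces}"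
    using card_mono[of "ear ` {k. k < n \<and> ear k \<in> faces}" "faces \<inter> ear ` {..<n}"]
      card_image_le[of "{k. k < n \<and> ear k \<in> faces}" ear] by simp
  ultimately show ?thesis unfolding ear_def by linarith
qed

end

subsection \<open>Removing a vertex while preserving balance\<close>

text \<open>If the origin were outside the convex hull, a separating plane would put all vertices
  into an open hemisphere. This translates balance into linear algebra.\<close>

lemma balanced_relation:
  assumes V: "finite V" "balanced_set V"
  obtains \<mu> where "\<And>x. x \<in> V \<Longrightarrow> 0 \<le> \<mu> x" "(\<Sum>x\<in>V. \<mu> x *\<^sub>R x) = 0" "\<exists>x\<in>V. \<mu> x \<noteq> (0::real)"
proof -
  have "0 \<in> convex hull V"
  proof (rule ccontr)
    assume "0 \<notin> convex hull V"
    moreover have "closed (convex hull V)"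
      using V(1) by (intro compact_imp_closed compact_convex_hull finite_imp_compact)
    ultimately obtain w b where "w \<noteq> 0" "0 < b" "\<forall>x\<in>convex hull V. b < w \<bullet> x"
      using separating_hyperplane_closed_0[of "convex hull V"] by auto
    moreover have "0 < v \<bullet> w" if "v \<in> V" for v
      using calculation hull_inc[OF that, of convex] by (auto simp: inner_commute)
    ultimately show False using V(2) unfolding balanced_set_def by force
  qed
  then obtain \<mu> where \<mu>: "\<forall>x\<in>V. 0 \<le> \<mu> x" "sum \<mu> V = 1" "(\<Sum>x\<in>V. \<mu> x *\<^sub>R x) = 0"
    unfolding convex_hull_finite[OF V(1)] by blast
  moreover have "\<exists>x\<in>V. \<mu> x \<noteq> 0"
  proof (rule ccontr)
    assume "\<not> (\<exists>x\<in>V. \<mu> x \<noteq> 0)"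
    then have "sum \<mu> V = 0" by simp
    then show False using \<mu>(2) by simp
  qed
  ultimately show thesis using that by blast
qed

lemma generic_relation_support:
  assumes V: "finite V" "generic_set V" "3 \<le> card V"
    and rel: "(\<Sum>x\<in>V. \<mu> x *\<^sub>R x) = 0" "\<exists>x\<in>V. \<mu> x \<noteq> 0"
  shows "4 \<le> card {x \<in> V. \<mu> x \<noteq> 0}"
proof (rule ccontr)
  let ?Z = "{x \<in> V. \<mu> x \<noteq> 0}"
  assume "\<not> 4 \<le> card ?Z"
  then have "card ?Z \<le> 3" by simp
  then obtain Y where Y: "?Z \<subseteq> Y" "Y \<subseteq> V" "card Y = 3"
    using exists_subset_between[of ?Z 3 V] V by auto
  then obtain a b c where abc: "Y = {a, b, c}" "a \<noteq> b" "b \<noteq> c" "a \<noteq> c" by (auto simp: card_3_iff)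
  have D: "det3 a b c \<noteq> 0" using generic_setD[OF V(2)] abc Y by auto
  have "(\<Sum>x\<in>V. \<mu> x *\<^sub>R x) = (\<Sum>x\<in>Y. \<mu> x *\<^sub>R x)"
    using Y V(1) by (intro sum.mono_neutral_right) auto
  then have e: "\<mu> a *\<^sub>R a + \<mu> b *\<^sub>R b + \<mu> c *\<^sub>R c = 0" using rel(1) abc by (simp add: add.assoc)
  have "det3 (\<mu> a *\<^sub>R a + \<mu> b *\<^sub>R b + \<mu> c *\<^sub>R c) b c = 0" "det3 a (\<mu> a *\<^sub>R a + \<mu> b *\<^sub>R b + \<mu> c *\<^sub>R c) c = 0"
    "det3 a b (\<mu> a *\<^sub>R a + \<mu> b *\<^sub>R b + \<mu> c *\<^sub>R c) = 0" unfolding e by simp_all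
  then have "\<mu> a = 0" "\<mu> b = 0" "\<mu> c = 0" using D by simp_all
  then show False using rel(2) Y abc by auto
qed

text \<open>Otherwise pair the relation with the normal \<open>w\<close> of a hemisphere containing
  the other vertices. All terms are nonnegative with sum zero, so \<open>w\<close> is orthogonal to
  the support, which contains three independent vectors.\<close>

lemma essential_vertex_positive:
  assumes V: "finite V" "generic_set V" "3 \<le> card V"
    and y: "y \<in> V" "\<not> balanced_set (V - {y})"
    and rel: "\<And>x. x \<in> V \<Longrightarrow> 0 \<le> \<mu> x" "(\<Sum>x\<in>V. \<mu> x *\<^sub>R x) = 0" "\<exists>x\<in>V. \<mu> x \<noteq> 0"
  shows "0 < \<mu> y"
proof (rule ccontr)
  assume "\<not> 0 < \<mu> y"
  then have y0: "\<mu> y = 0" using rel(1)[OF y(1)] by simp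
  obtain w where w: "w \<noteq> 0" "\<not> (\<exists>v\<in>V - {y}. v \<bullet> w < 0)"
    using y(2) unfolding balanced_set_def by blast
  have w_pos: "0 \<le> x \<bullet> w" if "x \<in> V" "x \<noteq> y" for x
  proof (rule ccontr)
    assume "\<not> 0 \<le> x \<bullet> w"
    then have "x \<bullet> w < 0" by simp
    then show False using w(2) that by blast
  qed
  have "(\<Sum>x\<in>V. \<mu> x * (x \<bullet> w)) = (\<Sum>x\<in>V. \<mu> x *\<^sub>R x) \<bullet> w" by (simp add: inner_sum_left)
  also have "\<dots> = 0" using rel(2) by simp
  finally have "(\<Sum>x\<in>V. \<mu> x * (x \<bullet> w)) = 0" .
  moreover have "0 \<le> \<mu> x * (x \<bullet> w)" if "x \<in> V" for x
    using rel(1)[OF that] w_pos[OF that] y0 by (cases "x = y") auto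
  ultimately have zero: "\<mu> x * (x \<bullet> w) = 0" if "x \<in> V" for x
    using sum_nonneg_eq_0_iff[OF V(1), of "\<lambda>x. \<mu> x * (x \<bullet> w)"] that by blast
  have "3 \<le> card {x \<in> V. \<mu> x \<noteq> 0}" using generic_relation_support[OF V rel(2,3)] by linarith
  then obtain Z where Z: "Z \<subseteq> {x \<in> V. \<mu> x \<noteq> 0}" "card Z = 3"
    by (rule obtain_subset_with_card_n)
  then obtain a b c where abc: "Z = {a, b, c}" "a \<noteq> b" "b \<noteq> c" "a \<noteq> c" by (auto simp: card_3_iff)
  then have D: "det3 a b c \<noteq> 0" using generic_setD[OF V(2)] Z by auto
  have orth: "a \<bullet> w = 0" "b \<bullet> w = 0" "c \<bullet> w = 0" using zero abc Z by auto
  obtain i j k where "w = i *\<^sub>R a + j *\<^sub>R b + k *\<^sub>R c" using det3_coords[OF D] .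
  then have "w \<bullet> w = (i *\<^sub>R a + j *\<^sub>R b + k *\<^sub>R c) \<bullet> w" by simp
  also have "\<dots> = 0" using orth by (simp add: inner_add_left)
  finally show False using w by simp
qed

text \<open>Every nonnegative linear relation among the vertices has positive coefficients at the vertices
  whose deletion destroys balance. Exchanging a further vertex into such a relation makes one of the
  coefficients at any four of them vanish.\<close>

lemma balanced_removable_vertex:
  assumes V: "finite V" "generic_set V" "balanced_set V" "5 \<le> card V" and X: "X \<subseteq> V" "4 \<le> card X"
  shows "\<exists>x\<in>X. balanced_set (V - {x})"
proof (rule ccontr)
  assume none: "\<not> (\<exists>x\<in>X. balanced_set (V - {x}))"
  have V3: "3 \<le> card V" using V by simp
  have ess: "0 < \<mu> y"
    if "y \<in> X" "\<And>x. x \<in> V \<Longrightarrow> 0 \<le> \<mu> x" "(\<Sum>x\<in>V. \<mu> x *\<^sub>R x) = 0" "\<exists>x\<in>V. \<mu> x \<noteq> 0" for y \<mu>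
  proof (rule essential_vertex_positive[OF V(1,2) V3 _ _ that(2-4)])
    show "y \<in> V" "\<not> balanced_set (V - {y})" using that(1) none X(1) by blast+
  qed
  obtain Y where Y: "Y \<subseteq> X" "card Y = 4" by (rule obtain_subset_with_card_n[OF X(2)])
  have finY: "finite Y" using Y(2) card_ge_0_finite[of Y] by simp
  have "Y \<noteq> {}" using Y(2) by auto
  then obtain d where d: "d \<in> Y" by blast
  then have "card (Y - {d}) = 3" using Y(2) finY by simp
  then obtain a b c where abc: "Y - {d} = {a, b, c}" "a \<noteq> b" "b \<noteq> c" "a \<noteq> c" by (auto simp: card_3_iff)
  then have "a \<in> Y" "b \<in> Y" "c \<in> Y" "d \<notin> {a, b, c}" by blast+
  then have inX: "a \<in> X" "b \<in> X" "c \<in> X" "d \<in> X" "d \<notin> {a, b, c}" using Y(1) d by auto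
  then have inV: "a \<in> V" "b \<in> V" "c \<in> V" "d \<in> V" using X(1) by auto
  have "\<not> V \<subseteq> Y" using card_mono[OF finY, of V] V(4) Y(2) by auto
  then obtain e where e: "e \<in> V" "e \<notin> Y" by blast
  have ne: "e \<noteq> a" "e \<noteq> b" "e \<noteq> c" "e \<noteq> d"
    using e(2) d \<open>a \<in> Y\<close> \<open>b \<in> Y\<close> \<open>c \<in> Y\<close> by auto
  have "det3 a b c \<noteq> 0" using generic_setD[OF V(2)] inV abc by auto
  then obtain i j k where e_abc: "e = i *\<^sub>R a + j *\<^sub>R b + k *\<^sub>R c" by (rule det3_coords)
  \<comment> \<open>The coefficients of the relation e - i a - j b - k c = 0. They vanish at
    \<open>d\<close>, and the coefficient 1 at \<open>e\<close> confines negative ones to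
    \<open>a\<close>, \<open>b\<close>, \<open>c\<close>. If none were negative, this relation would
    already contradict that \<open>d\<close> is indispensable.\<close>
  define \<kappa> where "\<kappa> x = (if x = e then 1 else 0) - (if x = a then i else 0) - (if x = b then j else 0)
    - (if x = c then k else 0)" for x
  have "(\<Sum>x\<in>V. \<kappa> x *\<^sub>R x) = (\<Sum>x\<in>V. (if x = e then x else 0) - (if x = a then i *\<^sub>R x else 0)
      - (if x = b then j *\<^sub>R x else 0) - (if x = c then k *\<^sub>R x else 0))"
    by (intro sum.cong) (auto simp: \<kappa>_def algebra_simps)
  also have "\<dots> = e - i *\<^sub>R a - j *\<^sub>R b - k *\<^sub>R c"
    using V(1) inV e by (simp add: sum_subtractf)
  also have "\<dots> = 0" by (subst e_abc) simp
  finally have \<kappa>0: "(\<Sum>x\<in>V. \<kappa> x *\<^sub>R x) = 0" .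
  have \<kappa>e: "\<kappa> e = 1" using ne by (simp add: \<kappa>_def)
  have \<kappa>d: "\<kappa> d = 0" using ne inX(5) by (auto simp: \<kappa>_def)
  define K where "K = {x \<in> V. \<kappa> x < 0}"
  have KX: "K \<subseteq> X" using inX unfolding K_def \<kappa>_def by (auto split: if_splits)
  have finK: "finite K" unfolding K_def using V(1) by simp
  have "K \<noteq> {}"
  proof
    assume "K = {}"
    then have "0 \<le> \<kappa> x" if "x \<in> V" for x using that unfolding K_def by (auto simp: not_less)
    then have "0 < \<kappa> d" using \<kappa>0 \<kappa>e e(1) inX(4) by (intro ess) (auto intro!: bexI[of _ e])
    then show False using \<kappa>d by simp
  qed
  obtain \<mu> where \<mu>: "\<And>x. x \<in> V \<Longrightarrow> 0 \<le> \<mu> x" "(\<Sum>x\<in>V. \<mu> x *\<^sub>R x) = 0" "\<exists>x\<in>V. \<mu> x \<noteq> (0::real)"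
    using balanced_relation[OF V(1,3)] by blast
  from finite_has_max[OF finK \<open>K \<noteq> {}\<close>, of "\<lambda>x. \<mu> x / \<kappa> x"]
  obtain y where y: "y \<in> K" and y_max: "\<forall>x\<in>K. \<mu> x / \<kappa> x \<le> \<mu> y / \<kappa> y" by (rule bexE)
  \<comment> \<open>The largest multiple of \<kappa> that can be added to \<mu> without a negative
    coefficient; the coefficient at \<open>y\<close> is the one that becomes zero.\<close>
  define t where "t = - (\<mu> y / \<kappa> y)"
  have \<kappa>y: "\<kappa> y < 0" using y unfolding K_def by simp
  have t: "0 \<le> t" using \<mu>(1)[of y] y \<kappa>y unfolding t_def K_def by (simp add: divide_nonneg_neg)
  define \<nu> where "\<nu> x = \<mu> x + t * \<kappa> x" for x
  have "0 < \<nu> y"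
  proof (rule ess)
    show "y \<in> X" using y KX by blast
    show "0 \<le> \<nu> x" if x: "x \<in> V" for x
    proof (cases "\<kappa> x < 0")
      case True
      then have "\<mu> x / \<kappa> x \<le> - t" using y_max x unfolding t_def K_def by auto
      then have "- t * \<kappa> x \<le> \<mu> x" using True by (simp add: neg_divide_le_eq)
      then show ?thesis by (simp add: \<nu>_def)
    next
      case False
      then show ?thesis using t \<mu>(1)[OF x] by (simp add: \<nu>_def)
    qed
    have "(\<Sum>x\<in>V. \<nu> x *\<^sub>R x) = (\<Sum>x\<in>V. \<mu> x *\<^sub>R x) + t *\<^sub>R (\<Sum>x\<in>V. \<kappa> x *\<^sub>R x)"
      by (simp add: \<nu>_def scaleR_add_left sum.distrib scaleR_sum_right)
    then show "(\<Sum>x\<in>V. \<nu> x *\<^sub>R x) = 0" using \<mu>(2) \<kappa>0 by simp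
    \<comment> \<open>Since \<kappa> vanishes at \<open>d\<close>, the exchange leaves the positive
      coefficient there untouched, so the new relation is not trivial.\<close>
    have "0 < \<mu> d" using \<mu> inX(4) by (intro ess) auto
    then show "\<exists>x\<in>V. \<nu> x \<noteq> 0" using inV(4) \<kappa>d by (intro bexI[of _ d]) (auto simp: \<nu>_def)
  qed
  moreover have "\<nu> y = 0" unfolding \<nu>_def t_def using \<kappa>y by simp
  ultimately show False by simp
qed

subsection \<open>Cutting off an ear\<close>

text \<open>Followed to the side of \<open>a\<close>, an arc crossing \<open>p q\<close> would end
  in the empty ear or cross \<open>p a\<close> or \<open>a q\<close>. Arcs at \<open>a\<close>
  itself could cross \<open>p q\<close> freely, hence the condition on \<open>M'\<close>.\<close>

lemma shortcut_noncrossing: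
  assumes V: "generic_set V" "p \<in> V" "a \<in> V" "q \<in> V" "p \<noteq> a" "a \<noteq> q" "p \<noteq> q"
    and M: "M \<subseteq> {{a, b} | a b. a \<in> V \<and> b \<in> V \<and> a \<noteq> b}" "noncrossing M" "{p, a} \<in> M" "{a, q} \<in> M"
    and empty: "V \<inter> open_cone3 p a q = {}"
    and M': "M' \<subseteq> M" "\<And>e. e \<in> M' \<Longrightarrow> a \<notin> e"
  shows "noncrossing (insert {p, q} M')"
proof (rule noncrossing_insert)
  show "noncrossing M'" using M(2) M'(1) by (rule noncrossing_mono)
  fix f' g' assume fg': "{f', g'} \<in> M'" "{f', g'} \<noteq> {p, q}"
  show "open_cone2 p q \<inter> open_cone2 f' g' = {}"
  proof (rule ccontr)
    assume "open_cone2 p q \<inter> open_cone2 f' g' \<noteq> {}"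
    then obtain s where s: "s \<in> open_cone2 p q" "s \<in> open_cone2 f' g'" by blast
    have "{f', g'} \<in> {{a, b} | a b. a \<in> V \<and> b \<in> V \<and> a \<noteq> b}" using fg' M M' by blast
    then have f'g'V: "f' \<in> V" "g' \<in> V" "f' \<noteq> g'" by (auto simp: doubleton_eq_iff)
    have f'g'a: "f' \<noteq> a" "g' \<noteq> a" using M'(2)[OF fg'(1)] by auto
    note dist' = generic_crossing_disjoint[OF V(1) f'g'V(1,2) V(2,4) f'g'V(3) V(7) fg'(2) s(2,1)]
    have D: "det3 p a q \<noteq> 0" using generic_setD[OF V(1)] V by auto
    define L where "L z = det3 p z q / det3 p a q" for z
    have L: "L (i *\<^sub>R p + j *\<^sub>R a + k *\<^sub>R q) = j" for i j k using D by (simp add: L_def)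
    obtain s1 s2 where s12: "0 < s1" "0 < s2" "s = s1 *\<^sub>R p + s2 *\<^sub>R q" using s(1) by (rule open_cone2E)
    obtain \<phi> \<eta> where fgs: "0 < \<phi>" "0 < \<eta>" "s = \<phi> *\<^sub>R f' + \<eta> *\<^sub>R g'" using s(2) by (rule open_cone2E)
    have "\<phi> * L f' + \<eta> * L g' = L s" unfolding fgs(3) L_def by (simp add: add_divide_distrib)
    also have "L s = 0" unfolding s12 L_def by simp
    finally have L0: "\<phi> * L f' + \<eta> * L g' = 0" .
    have "det3 p f' q \<noteq> 0" using generic_setD[OF V(1), of p f' q] V f'g'V dist' by auto
    then have "L f' \<noteq> 0" using D by (simp add: L_def)
    then have "0 < L f' \<or> 0 < L g'" using L0 fgs(1,2)
      by (smt (verit) mult_pos_neg zero_less_mult_iff)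
    then obtain f g where fg: "{f, g} \<in> M'" "f \<in> V" "g \<in> V" "f \<noteq> g" "f \<noteq> a" "g \<noteq> a" "f \<noteq> p" "f \<noteq> q"
        "s \<in> open_cone2 f g" "0 < L f"
    proof
      assume "0 < L f'"
      then show thesis using that[of f' g'] fg' f'g'V f'g'a dist' s(2) by auto
    next
      assume "0 < L g'"
      then show thesis using that[of g' f'] fg' f'g'V f'g'a dist' s(2)
        by (auto simp: insert_commute open_cone2_commute[of g' f'])
    qed
    have fgM: "{f, g} \<in> M" using fg(1) M'(1) by blast
    have a_notin: "x *\<^sub>R a \<notin> open_cone2 f g" for x
      using generic_vertex_notin_cone[OF V(1,3) fg(2,3), of x] fg by auto
    obtain i j k where f: "f = i *\<^sub>R p + j *\<^sub>R a + k *\<^sub>R q" using det3_coords[OF D] .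
    have j: "0 < j" using fg(10) unfolding f L .
    from s12(3,1,2) f j show False
    proof (cases rule: exit_side)
      case 1
      have "k \<noteq> 0"
      proof
        assume "k = 0"
        then have "det3 p a f = 0" unfolding f by simp
        then show False using generic_setD[OF V(1), of p a f] fg V by auto
      qed
      moreover have "i \<noteq> 0"
      proof
        assume "i = 0"
        then have "det3 a q f = 0" unfolding f by simp
        then show False using generic_setD[OF V(1), of a q f] fg V by auto
      qed
      ultimately have "f \<in> open_cone3 p a q" using 1 j unfolding f by (auto intro!: open_cone3I)
      then show False using fg(2) empty by blast
    next
      case (2 t x y)
      have in_fg: "s + t *\<^sub>R f \<in> open_cone2 f g" using fg(9) 2(1) by (rule open_cone2_add)
      then have "y \<noteq> 0" using a_notin[of x] 2(4) by auto
      then have "s + t *\<^sub>R f \<in> open_cone2 a q" using 2 by (auto intro!: open_cone2I)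
      then have "{f, g} = {a, q}" using noncrossingD[OF M(2) fgM M(4)] in_fg by blast
      then show False using fg by (auto simp: doubleton_eq_iff)
    next
      case (3 t x y)
      have in_fg: "s + t *\<^sub>R f \<in> open_cone2 f g" using fg(9) 3(1) by (rule open_cone2_add)
      have "s + t *\<^sub>R f \<in> open_cone2 p a" using 3 by (auto intro!: open_cone2I)
      then have "{f, g} = {p, a}" using noncrossingD[OF M(2) fgM M(3)] in_fg by blast
      then show False using fg by (auto simp: doubleton_eq_iff)
    qed
  qed
qed

text \<open>Cutting off an empty ear at \<open>a\<close> can change the turn at a neighbour \<open>p\<close> only towards the turn
  at \<open>a\<close>: otherwise the edge from \<open>p\<close> to \<open>h\<close> would enter the ear.\<close>

lemma shortcut_turn:
  assumes V: "generic_set V" "p \<in> V" "a \<in> V" "q \<in> V" "h \<in> V" "p \<noteq> a" "a \<noteq> q" "p \<noteq> q"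
      "h \<noteq> p" "h \<noteq> a" "h \<noteq> q"
    and empty: "V \<inter> open_cone3 p a q = {}" and nonx: "open_cone2 h p \<inter> open_cone2 a q = {}"
    and turn: "0 < det3 h p a * det3 p a q"
  shows "0 < det3 h p q * det3 p a q"
proof (rule ccontr)
  assume not: "\<not> 0 < det3 h p q * det3 p a q"
  have D: "det3 p a q \<noteq> 0" using generic_setD[OF V(1)] V by auto
  have "det3 h p q \<noteq> 0" using generic_setD[OF V(1)] V by auto
  then have neg: "det3 h p q * det3 p a q < 0" using D not by (simp add: less_le)
  \<comment> \<open>The old turn makes \<open>z\<close> positive and a wrong new turn makes
    \<open>y\<close> positive, so \<open>h\<close> lies in the sector of the ear at
    \<open>p\<close>. By the sign of \<open>x\<close> it is in the ear, on the side
    \<open>a q\<close>, or beyond it.\<close>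
  obtain x y z where h: "h = x *\<^sub>R p + y *\<^sub>R a + z *\<^sub>R q" using det3_coords[OF D] .
  have "det3 h p a = z * det3 p a q" unfolding h by (simp add: det3_rotate[of p a q])
  then have "0 < z * (det3 p a q)\<^sup>2" using turn by (simp add: power2_eq_square ac_simps)
  then have z: "0 < z" by (simp add: zero_less_mult_iff)
  have "det3 h p q = - y * det3 p a q" unfolding h by (simp add: det3_swap12[of p a q])
  then have "0 < y * (det3 p a q)\<^sup>2" using neg by (simp add: power2_eq_square ac_simps)
  then have y: "0 < y" by (simp add: zero_less_mult_iff)
  consider "0 < x" | "x = 0" | "x < 0" by linarith
  then show False
  proof cases
    case 1
    then show False using empty V(5) open_cone3I[OF 1 y z, of p a q] h by auto
  next
    case 2
    then have "1 *\<^sub>R h \<in> open_cone2 a q" using h y z by (auto intro: open_cone2I)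
    then show False using generic_vertex_notin_cone[OF V(1), of h a q 1] V by blast
  next
    case 3
    have "1 *\<^sub>R h + (- x) *\<^sub>R p \<in> open_cone2 h p" using 3 by (intro open_cone2I) auto
    moreover have "1 *\<^sub>R h + (- x) *\<^sub>R p = y *\<^sub>R a + z *\<^sub>R q" using h by simp
    moreover have "y *\<^sub>R a + z *\<^sub>R q \<in> open_cone2 a q" using y z by (rule open_cone2I)
    ultimately show False using nonx by (metis disjoint_iff)
  qed
qed

text \<open>The entry \<open>l + 2\<close> is deleted and its neighbours are replaced. A neighbour
  that agrees with this entry keeps agreeing, so neither half of the sequence up to or from it gains
  changes; dropping the entry then gains none by the triangle inequality.\<close>

lemma cyclic_sign_changes_shorten:
  fixes d d' :: "nat \<Rightarrow> real"
  assumes eq: "\<And>i. i \<le> l \<Longrightarrow> d' i = d i"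
    and nz: "\<And>i. i < l + 4 \<Longrightarrow> d i \<noteq> 0" "d' (l + 1) \<noteq> 0" "d' (l + 2) \<noteq> 0"
    and 1: "0 < d (l + 1) * d (l + 2) \<Longrightarrow> 0 < d' (l + 1) * d (l + 2)"
    and 2: "0 < d (l + 3) * d (l + 2) \<Longrightarrow> 0 < d' (l + 2) * d (l + 2)"
  shows "card {i. i < l + 3 \<and> d' i * d' (Suc i mod (l + 3)) < 0}
    \<le> card {i. i < l + 4 \<and> d i * d (Suc i mod (l + 4)) < 0}"
proof -
  have card_sum: "card {i. i < n \<and> P i} = (\<Sum>i<n. of_bool (P i))" for n and P :: "nat \<Rightarrow> bool"
    by (simp add: sum.If_cases Int_def of_bool_def)
  have neg: "x * y < 0 \<longleftrightarrow> (0 < x) \<noteq> (0 < y)" "0 < x * y \<longleftrightarrow> (0 < x) = (0 < y)"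
    if "x \<noteq> 0" "y \<noteq> 0" for x y :: real
    using that by (auto simp: mult_less_0_iff zero_less_mult_iff)
  have count: "of_bool (x \<noteq> A') + of_bool (A' \<noteq> B') + of_bool (B' \<noteq> y) \<le>
      of_bool (x \<noteq> A) + of_bool (A \<noteq> D) + of_bool (D \<noteq> B) + (of_bool (B \<noteq> y) :: nat)"
    if "A = D \<Longrightarrow> A' = D" "B = D \<Longrightarrow> B' = D" for x A D B y A' B' :: bool
    using that by (cases x; cases y; cases A; cases B; cases D; auto)
  have sum3: "(\<Sum>i<l + 3. f i) = (\<Sum>i<l. f i) + f l + f (l + 1) + f (l + 2)" for f :: "nat \<Rightarrow> nat"
    by (simp add: numeral_3_eq_3)
  have sum4: "(\<Sum>i<l + 4. f i) = (\<Sum>i<l. f i) + f l + f (l + 1) + f (l + 2) + f (l + 3)"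
    for f :: "nat \<Rightarrow> nat"
    using lessThan_Suc[of "l + 3"] sum3[of f] by (simp add: add.commute[of l] eval_nat_numeral)
  have mods: "Suc l mod (l + 3) = l + 1" "Suc (l + 1) mod (l + 3) = l + 2" "Suc (l + 2) mod (l + 3) = 0"
    "Suc l mod (l + 4) = l + 1" "Suc (l + 1) mod (l + 4) = l + 2" "Suc (l + 2) mod (l + 4) = l + 3"
    "Suc (l + 3) mod (l + 4) = 0"
    by (auto simp: mod_if)
  have "(\<Sum>i<l. of_bool (d' i * d' (Suc i mod (l + 3)) < 0)) =
      (\<Sum>i<l. of_bool (d i * d (Suc i mod (l + 4)) < 0) :: nat)"
    by (intro sum.cong) (simp_all add: eq)
  moreover have "of_bool (d l * d' (l + 1) < 0) + of_bool (d' (l + 1) * d' (l + 2) < 0)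
      + of_bool (d' (l + 2) * d 0 < 0) \<le>
      of_bool (d l * d (l + 1) < 0) + of_bool (d (l + 1) * d (l + 2) < 0)
      + of_bool (d (l + 2) * d (l + 3) < 0) + (of_bool (d (l + 3) * d 0 < 0) :: nat)"
  proof -
    have nz': "d l \<noteq> 0" "d (l + 1) \<noteq> 0" "d (l + 2) \<noteq> 0" "d (l + 3) \<noteq> 0" "d 0 \<noteq> 0"
      by (auto intro!: nz(1))
    show ?thesis unfolding neg(1)[OF nz'(1) nz(2)] neg(1)[OF nz(2,3)] neg(1)[OF nz(3) nz'(5)]
        neg(1)[OF nz'(1,2)] neg(1)[OF nz'(2,3)] neg(1)[OF nz'(3,4)] neg(1)[OF nz'(4,5)]
      using 1 2 unfolding neg(2)[OF nz'(2,3)] neg(2)[OF nz(2) nz'(3)] neg(2)[OF nz'(4,3)] neg(2)[OF nz(3) nz'(3)]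
      by (rule count)
  qed
  ultimately show ?thesis unfolding card_sum sum3 sum4 mods eq[OF order_refl] eq[OF le0] by linarith
qed

definition edges :: "nat \<Rightarrow> (nat \<Rightarrow> real^3) \<Rightarrow> (real^3) set set" where
  "edges n u = {{u i, u (Suc i mod n)} | i. i < n}"

definition simple_polygon :: "nat \<Rightarrow> (nat \<Rightarrow> real^3) \<Rightarrow> bool" where
  "simple_polygon n u \<longleftrightarrow> inj_on u {..<n} \<and> generic_set (u ` {..<n}) \<and> noncrossing (edges n u)"

text \<open>The turn at index \<open>i\<close> is taken at the middle vertex i + 1. A sign change
  between \<open>i\<close> and i + 1 therefore belongs to the edge from vertex i + 1 to i +
  2.\<close>

definition turn :: "nat \<Rightarrow> (nat \<Rightarrow> real^3) \<Rightarrow> nat \<Rightarrow> real" where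
  "turn n u i = det3 (u i) (u (Suc i mod n)) (u ((i + 2) mod n))"

definition sign_changes :: "nat \<Rightarrow> (nat \<Rightarrow> real^3) \<Rightarrow> nat" where
  "sign_changes n u = card {i. i < n \<and> turn n u i * turn n u (Suc i mod n) < 0}"

lemma edges_subset:
  assumes "inj_on u {..<n}" "2 \<le> n"
  shows "edges n u \<subseteq> {{a, b} | a b. a \<in> u ` {..<n} \<and> b \<in> u ` {..<n} \<and> a \<noteq> b}"
proof
  fix e assume "e \<in> edges n u"
  then obtain i where i: "i < n" "e = {u i, u (Suc i mod n)}" unfolding edges_def by blast
  have "u i \<noteq> u (Suc i mod n)"
    using inj_on_eq_iff[OF assms(1), of i "Suc i mod n"] mod_shift_neq[of i n 0 1] i assms(2) by auto
  moreover have "u i \<in> u ` {..<n}" "u (Suc i mod n) \<in> u ` {..<n}" using i by auto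
  ultimately show "e \<in> {{a, b} | a b. a \<in> u ` {..<n} \<and> b \<in> u ` {..<n} \<and> a \<noteq> b}" using i(2) by blast
qed

lemma turn_nonzero:
  assumes "simple_polygon n u" "3 \<le> n" "i < n"
  shows "turn n u i \<noteq> 0"
proof -
  have inj: "inj_on u {..<n}" and gen: "generic_set (u ` {..<n})" using assms(1) unfolding simple_polygon_def by auto
  show ?thesis unfolding turn_def
    using assms mod_shift_neq[of i n 0 1] mod_shift_neq[of i n 0 2] mod_shift_neq[of i n 1 2]
    by (intro generic_setD[OF gen]) (auto simp: inj_on_eq_iff[OF inj])
qed

lemma bij_betw_rotate:
  fixes n r :: nat
  assumes "0 < n"
  shows "bij_betw (\<lambda>i. (i + r) mod n) {..<n} {..<n}"
proof -
  have "inj_on (\<lambda>i. (i + r) mod n) {..<n}"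
  proof (rule inj_onI)
    fix i j assume ij: "i \<in> {..<n}" "j \<in> {..<n}" "(i + r) mod n = (j + r) mod n"
    have "(r mod n + i) mod n = (r mod n + j) mod n" using ij(3) by (simp add: mod_simps add.commute)
    then show "i = j" using mod_shift_neq[of "r mod n" n i j] ij assms by auto
  qed
  moreover have "(\<lambda>i. (i + r) mod n) ` {..<n} \<subseteq> {..<n}" using assms by auto
  ultimately show ?thesis by (simp add: bij_betw_def endo_inj_surj)
qed

text \<open>Cyclic renumbering brings any ear tip to the last index, where its removal merely
  shortens the index range.\<close>

lemma rotate_polygon:
  fixes u :: "nat \<Rightarrow> real^3"
  assumes n: "0 < n" and v: "v = (\<lambda>i. u ((i + r) mod n))"
  shows "v ` {..<n} = u ` {..<n}" "edges n v = edges n u" "inj_on u {..<n} \<Longrightarrow> inj_on v {..<n}"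
    "sign_changes n v = sign_changes n u"
proof -
  let ?\<rho> = "\<lambda>i. (i + r) mod n"
  have bij: "bij_betw ?\<rho> {..<n} {..<n}" using n by (rule bij_betw_rotate)
  have v\<rho>: "v = (\<lambda>i. u (?\<rho> i))" by (rule v)
  have im: "?\<rho> ` {..<n} = {..<n}" using bij by (rule bij_betw_imp_surj_on)
  show "v ` {..<n} = u ` {..<n}" using im unfolding v\<rho> by (metis image_image)
  have suc: "v (Suc i mod n) = u (Suc (?\<rho> i) mod n)" for i unfolding v by (simp add: mod_simps)
  have suc2: "v ((i + 2) mod n) = u ((?\<rho> i + 2) mod n)" for i
    unfolding v by (simp add: mod_simps)
  have "edges n v = (\<lambda>i. {u i, u (Suc i mod n)}) ` (?\<rho> ` {..<n})"
    unfolding edges_def suc by (auto simp: v)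
  then show "edges n v = edges n u" unfolding im edges_def by auto
  show "inj_on v {..<n}" if "inj_on u {..<n}"
    using comp_inj_on[of ?\<rho> "{..<n}" u] that bij unfolding v\<rho> bij_betw_def comp_def by simp
  have turn: "turn n v i = turn n u (?\<rho> i)" for i unfolding turn_def suc suc2 by (simp add: v)
  have turn_suc: "turn n v (Suc i mod n) = turn n u (Suc (?\<rho> i) mod n)" for i
    unfolding turn by (simp add: mod_simps)
  let ?P = "\<lambda>i. turn n u i * turn n u (Suc i mod n) < 0"
  have "{i. i < n \<and> ?P i} = ?\<rho> ` {i. i < n \<and> ?P (?\<rho> i)}"
    using im by (auto simp: image_iff)
  moreover have "inj_on ?\<rho> {i. i < n \<and> ?P (?\<rho> i)}"
    using bij unfolding bij_betw_def by (auto intro: inj_on_subset)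
  ultimately have "card {i. i < n \<and> ?P i} = card {i. i < n \<and> ?P (?\<rho> i)}" by (simp add: card_image)
  then show "sign_changes n v = sign_changes n u" unfolding sign_changes_def turn_suc unfolding turn by simp
qed

lemma remove_last_vertex:
  fixes u :: "nat \<Rightarrow> real^3"
  assumes m: "4 \<le> m" and u: "simple_polygon (Suc m) u"
    and empty: "u ` {..<Suc m} \<inter> open_cone3 (u (m - 1)) (u m) (u 0) = {}"
  shows "simple_polygon m u" "sign_changes m u \<le> sign_changes (Suc m) u"
proof -
  let ?V = "u ` {..<Suc m}"
  have inj: "inj_on u {..<Suc m}" and gen: "generic_set ?V" and nonx: "noncrossing (edges (Suc m) u)"
    using u unfolding simple_polygon_def by auto
  have u_eq: "u i = u j \<longleftrightarrow> i = j" if "i < Suc m" "j < Suc m" for i j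
    using inj_on_eq_iff[OF inj] that by auto
  have edge: "{u i, u (Suc i)} \<in> edges (Suc m) u" if "i < m" for i
    unfolding edges_def using that by (auto intro!: exI[of _ i])
  have edge_last: "{u m, u 0} \<in> edges (Suc m) u" unfolding edges_def by (auto intro!: exI[of _ m])
  define M' where "M' = {{u i, u (Suc i)} | i. Suc i < m}"
  have M'_sub: "M' \<subseteq> edges (Suc m) u" unfolding M'_def using edge by auto
  have M'_a: "u m \<notin> e" if "e \<in> M'" for e using that u_eq unfolding M'_def by auto
  have "noncrossing (insert {u (m - 1), u 0} M')"
  proof (rule shortcut_noncrossing[OF gen _ _ _ _ _ _ _ nonx _ edge_last empty M'_sub M'_a])
    show "edges (Suc m) u \<subseteq> {{a, b} | a b. a \<in> ?V \<and> b \<in> ?V \<and> a \<noteq> b}"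
      using edges_subset[OF inj] m by simp
    show "{u (m - 1), u m} \<in> edges (Suc m) u" using edge[of "m - 1"] m by simp
  qed (use m u_eq in auto)
  moreover have "edges m u = insert {u (m - 1), u 0} M'"
  proof
    show "edges m u \<subseteq> insert {u (m - 1), u 0} M'"
    proof
      fix e assume "e \<in> edges m u"
      then obtain i where i: "i < m" "e = {u i, u (Suc i mod m)}" unfolding edges_def by blast
      show "e \<in> insert {u (m - 1), u 0} M'"
      proof (cases "Suc i < m")
        case False
        then have "i = m - 1" using i by simp
        then show ?thesis using i by simp
      qed (use i in \<open>auto simp: M'_def\<close>)
    qed
    show "insert {u (m - 1), u 0} M' \<subseteq> edges m u"
    proof
      fix e assume "e \<in> insert {u (m - 1), u 0} M'"
      then consider "e = {u (m - 1), u 0}" | i where "Suc i < m" "e = {u i, u (Suc i)}" unfolding M'_def by blast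
      then show "e \<in> edges m u"
      proof cases
        case 1
        then show ?thesis unfolding edges_def using m by (intro CollectI exI[of _ "m - 1"]) simp
      next
        case 2
        then show ?thesis unfolding edges_def by (intro CollectI exI[of _ i]) simp
      qed
    qed
  qed
  ultimately have "noncrossing (edges m u)" by simp
  moreover have "inj_on u {..<m}" using inj by (rule inj_on_subset) auto
  moreover have "generic_set (u ` {..<m})" using gen unfolding generic_set_def by auto
  ultimately show simple_m: "simple_polygon m u" unfolding simple_polygon_def by blast
  obtain l where l: "m = l + 3" "1 \<le> l" using m by (intro that[of "m - 3"]) auto
  have Suc_m: "Suc m = l + 4" using l by simp
  \<comment> \<open>Five successive vertices h, p, a, q, e around the tip \<open>a\<close>. The only
    turns that change are those at \<open>p\<close> and \<open>q\<close>, with indices l + 1 and l +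
    2 in the shortened polygon.\<close>
  define p a q h e where "p = u (l + 2)" and "a = u (l + 3)" and "q = u 0" and "h = u (l + 1)" and "e = u 1"
  have in_V: "p \<in> ?V" "a \<in> ?V" "q \<in> ?V" "h \<in> ?V" "e \<in> ?V"
    unfolding p_def a_def q_def h_def e_def using l by auto
  have ne: "p \<noteq> a" "a \<noteq> q" "p \<noteq> q" "h \<noteq> p" "h \<noteq> a" "h \<noteq> q" "e \<noteq> q" "e \<noteq> a" "e \<noteq> p"
    unfolding p_def a_def q_def h_def e_def using l u_eq by auto
  have empty': "?V \<inter> open_cone3 p a q = {}" using empty l by (simp add: p_def a_def q_def)
  have arcs: "{h, p} \<in> edges (Suc m) u" "{a, q} \<in> edges (Suc m) u" "{q, e} \<in> edges (Suc m) u" "{p, a} \<in> edges (Suc m) u"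
    using edge[of "l + 1"] edge[of "l + 2"] edge[of 0] edge_last l
    by (simp_all add: p_def a_def q_def h_def e_def eval_nat_numeral)
  have "Suc (l + 1) mod (l + 3) = l + 2" "(l + 1 + 2) mod (l + 3) = 0"
    "Suc (l + 2) mod (l + 3) = 0" "(l + 2 + 2) mod (l + 3) = 1"
    "Suc (l + 1) mod (l + 4) = l + 2" "(l + 1 + 2) mod (l + 4) = l + 3"
    "Suc (l + 2) mod (l + 4) = l + 3" "(l + 2 + 2) mod (l + 4) = 0"
    "Suc (l + 3) mod (l + 4) = 0" "(l + 3 + 2) mod (l + 4) = 1"
    by (auto simp: mod_if)
  then have turns: "turn (l + 3) u (l + 1) = det3 h p q" "turn (l + 3) u (l + 2) = det3 p q e"
    "turn (l + 4) u (l + 1) = det3 h p a" "turn (l + 4) u (l + 2) = det3 p a q"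
    "turn (l + 4) u (l + 3) = det3 a q e"
    unfolding turn_def p_def a_def q_def h_def e_def by (simp_all only:)
  have "sign_changes (l + 3) u \<le> sign_changes (l + 4) u" unfolding sign_changes_def
  proof (rule cyclic_sign_changes_shorten)
    show "turn (l + 3) u i = turn (l + 4) u i" if "i \<le> l" for i using that by (simp add: turn_def)
    show "turn (l + 4) u i \<noteq> 0" if "i < l + 4" for i using turn_nonzero[OF u] that Suc_m m by simp
    show "turn (l + 3) u (l + 1) \<noteq> 0" "turn (l + 3) u (l + 2) \<noteq> 0"
      using turn_nonzero[OF simple_m] l by auto
    have "open_cone2 h p \<inter> open_cone2 a q = {}"
      using noncrossingD[OF nonx arcs(1,2)] ne by (auto simp: doubleton_eq_iff)
    then show "0 < turn (l + 3) u (l + 1) * turn (l + 4) u (l + 2)"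
      if "0 < turn (l + 4) u (l + 1) * turn (l + 4) u (l + 2)"
      using shortcut_turn[OF gen in_V(1-4) ne(1-6) empty'] that unfolding turns by blast
    \<comment> \<open>The other neighbour is handled by traversing the polygon backwards. This
      negates every determinant, so the products keep their signs.\<close>
    have "open_cone2 e q \<inter> open_cone2 a p = {}"
      using noncrossingD[OF nonx arcs(3,4)] ne by (auto simp: doubleton_eq_iff open_cone2_commute)
    moreover have "?V \<inter> open_cone3 q a p = {}"
      using empty' open_cone3_swap12 open_cone3_swap23 by metis
    ultimately have "0 < det3 e q p * det3 q a p" if "0 < det3 e q a * det3 q a p"
      using shortcut_turn[OF gen in_V(3,2,1,5)] ne that by metis
    moreover have "det3 e q p = - det3 p q e" "det3 q a p = - det3 p a q" "det3 e q a = - det3 a q e"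
      by (simp_all add: det3_expand algebra_simps)
    ultimately show "0 < turn (l + 3) u (l + 2) * turn (l + 4) u (l + 2)"
      if "0 < turn (l + 4) u (l + 3) * turn (l + 4) u (l + 2)"
      using that unfolding turns by simp
  qed
  then show "sign_changes m u \<le> sign_changes (Suc m) u" unfolding Suc_m unfolding l(1) .
qed

lemma (in arc_triangulation) empty_if_faces:
  assumes "{a, b, c} \<in> faces" "a \<noteq> b" "b \<noteq> c" "a \<noteq> c"
  shows "V \<inter> open_cone3 a b c = {}"
proof -
  obtain x y z where xyz: "{a, b, c} = {x, y, z}" "face x y z" using assms(1) unfolding faces_def by blast
  have perms: "face x z y" "face y x z" "face y z x" "face z x y" "face z y x"
    using xyz(2) face_swap12 face_swap23 by blast+
  have "a \<in> {x, y, z}" "b \<in> {x, y, z}" "c \<in> {x, y, z}" using xyz(1) by blast+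
  then have "face a b c" using assms(2-4) xyz(2) perms by (elim insertE) auto
  then show ?thesis unfolding face_def by simp
qed

subsection \<open>The number of inflections\<close>

text \<open>Inserting the relation into \<open>det3 b c\<close> kills the terms of \<open>b\<close>
  and \<open>c\<close> and ties the two determinants together with opposite signs.\<close>

lemma balanced_tetrahedron_turn:
  assumes "\<alpha> *\<^sub>R a + \<beta> *\<^sub>R b + \<gamma> *\<^sub>R c + \<delta> *\<^sub>R d = 0" "0 < \<alpha>" "0 < \<delta>" "det3 a b c \<noteq> 0"
  shows "det3 a b c * det3 b c d < 0"
proof -
  have "det3 b c (\<alpha> *\<^sub>R a + \<beta> *\<^sub>R b + \<gamma> *\<^sub>R c + \<delta> *\<^sub>R d) = 0" unfolding assms(1) by simp
  then have "\<delta> * det3 b c d = - \<alpha> * det3 a b c" by (simp add: det3_rotate[of b c a])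
  then have "det3 a b c * (\<delta> * det3 b c d) = det3 a b c * (- \<alpha> * det3 a b c)" by simp
  then have "\<delta> * (det3 a b c * det3 b c d) = - (\<alpha> * (det3 a b c)\<^sup>2)"
    by (simp add: power2_eq_square ac_simps)
  moreover have "0 < \<alpha> * (det3 a b c)\<^sup>2" using assms by simp
  ultimately have "\<delta> * (det3 a b c * det3 b c d) < 0" by simp
  then show ?thesis using assms(3) \<open>0 < \<delta>\<close> by (simp add: mult_less_0_iff)
qed

text \<open>By generic position the nonnegative relation involves all four vertices, so its
  coefficients are positive and each of its four cyclic rotations forces a sign change.\<close>

lemma sign_changes_quadrilateral:
  fixes u :: "nat \<Rightarrow> real^3"
  assumes inj: "inj_on u {..<4}" and gen: "generic_set (u ` {..<4})" and bal: "balanced_set (u ` {..<4})"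
  shows "sign_changes 4 u = 4"
proof -
  let ?V = "u ` {..<4}"
  have card: "card ?V = 4" using card_image[OF inj] by simp
  obtain \<mu> where \<mu>: "\<And>x. x \<in> ?V \<Longrightarrow> 0 \<le> \<mu> x" "(\<Sum>x\<in>?V. \<mu> x *\<^sub>R x) = 0" "\<exists>x\<in>?V. \<mu> x \<noteq> (0::real)"
    by (rule balanced_relation[OF _ bal]) auto
  have "4 \<le> card {x \<in> ?V. \<mu> x \<noteq> 0}" using generic_relation_support[OF _ gen _ \<mu>(2,3)] card by simp
  then have "{x \<in> ?V. \<mu> x \<noteq> 0} = ?V" using card by (intro card_seteq) auto
  then have pos: "0 < \<mu> (u i)" if "i < 4" for i using \<mu>(1)[of "u i"] that by force
  have "(\<Sum>i<4. \<mu> (u i) *\<^sub>R u i) = 0" using \<mu>(2) by (simp add: sum.reindex[OF inj])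
  then have rel: "\<mu> (u 0) *\<^sub>R u 0 + \<mu> (u 1) *\<^sub>R u 1 + \<mu> (u 2) *\<^sub>R u 2 + \<mu> (u 3) *\<^sub>R u 3 = 0"
    by (simp add: eval_nat_numeral)
  have nz: "det3 (u i) (u j) (u k) \<noteq> 0" if "i < 4" "j < 4" "k < 4" "i \<noteq> j" "j \<noteq> k" "i \<noteq> k" for i j k
    using generic_setD[OF gen, of "u i" "u j" "u k"] that inj_on_eq_iff[OF inj] by auto
  have turns: "turn 4 u 0 = det3 (u 0) (u 1) (u 2)" "turn 4 u 1 = det3 (u 1) (u 2) (u 3)"
    "turn 4 u 2 = det3 (u 2) (u 3) (u 0)" "turn 4 u 3 = det3 (u 3) (u 0) (u 1)"
    by (simp_all add: turn_def flip: numeral_2_eq_2)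
  have "turn 4 u 0 * turn 4 u 1 < 0" unfolding turns
    by (rule balanced_tetrahedron_turn[OF rel]; (rule pos | rule nz)?; simp)
  moreover have "\<mu> (u 1) *\<^sub>R u 1 + \<mu> (u 2) *\<^sub>R u 2 + \<mu> (u 3) *\<^sub>R u 3 + \<mu> (u 0) *\<^sub>R u 0 = 0"
    using rel by (simp add: algebra_simps)
  then have "turn 4 u 1 * turn 4 u 2 < 0" unfolding turns
    by (rule balanced_tetrahedron_turn) ((rule pos | rule nz)?, simp)+
  moreover have "\<mu> (u 2) *\<^sub>R u 2 + \<mu> (u 3) *\<^sub>R u 3 + \<mu> (u 0) *\<^sub>R u 0 + \<mu> (u 1) *\<^sub>R u 1 = 0"
    using rel by (simp add: algebra_simps)
  then have "turn 4 u 2 * turn 4 u 3 < 0" unfolding turns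
    by (rule balanced_tetrahedron_turn) ((rule pos | rule nz)?, simp)+
  moreover have "\<mu> (u 3) *\<^sub>R u 3 + \<mu> (u 0) *\<^sub>R u 0 + \<mu> (u 1) *\<^sub>R u 1 + \<mu> (u 2) *\<^sub>R u 2 = 0"
    using rel by (simp add: algebra_simps)
  then have "turn 4 u 3 * turn 4 u 0 < 0" unfolding turns
    by (rule balanced_tetrahedron_turn) ((rule pos | rule nz)?, simp)+
  moreover have "i = 0 \<or> i = 1 \<or> i = 2 \<or> i = 3" if "i < 4" for i :: nat using that by presburger
  moreover have "Suc 0 mod 4 = 1" "Suc 1 mod 4 = 2" "Suc 2 mod 4 = 3" "Suc 3 mod 4 = (0::nat)" by simp_all
  ultimately have "turn 4 u i * turn 4 u (Suc i mod 4) < 0" if "i < 4" for i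
    using that by metis
  then have "{i. i < 4 \<and> turn 4 u i * turn 4 u (Suc i mod 4) < 0} = {..<4}" by auto
  then show ?thesis unfolding sign_changes_def by simp
qed

theorem balanced_simple_polygon_sign_changes:
  assumes "4 \<le> n" "simple_polygon n u" "balanced_set (u ` {..<n})"
  shows "4 \<le> sign_changes n u"
  using assms
proof (induction n arbitrary: u rule: dec_induct)
  case base
  then show ?case using sign_changes_quadrilateral unfolding simple_polygon_def by simp
next
  case (step m)
  let ?n = "Suc m" and ?V = "u ` {..<Suc m}"
  have inj: "inj_on u {..<?n}" and gen: "generic_set ?V" and nonx: "noncrossing (edges ?n u)"
    using step.prems unfolding simple_polygon_def by auto
  have u_eq: "u i = u j \<longleftrightarrow> i = j" if "i < ?n" "j < ?n" for i j
    using inj_on_eq_iff[OF inj] that by auto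
  have cardV: "card ?V = ?n" using card_image[OF inj] by simp
  have "3 \<le> card ?V" using cardV step.hyps by simp
  moreover have "edges ?n u \<subseteq> {{a, b} | a b. a \<in> ?V \<and> b \<in> ?V \<and> a \<noteq> b}"
    using edges_subset[OF inj] step.hyps by simp
  ultimately obtain M where M: "edges ?n u \<subseteq> M" "arc_triangulation ?V M"
    using exists_arc_triangulation[OF _ gen step.prems(2) _ _ nonx] by blast
  interpret arc_triangulation ?V M by (rule M(2))
  define K where "K = {k. k < ?n \<and> {u k, u (Suc k mod ?n), u ((k + 2) mod ?n)} \<in> faces}"
  have cardK: "4 \<le> card K" unfolding K_def
  proof (rule card_ears[OF _ inj])
    show "{u i, u (Suc i mod ?n)} \<in> M" if "i < ?n" for i using M(1) that unfolding edges_def by blast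
  qed (use step.hyps in auto)
  \<comment> \<open>An ear starting at \<open>k\<close> is cut at its middle vertex k + 1. Different
    ears have different tips, so there are at least four candidates for removal.\<close>
  have "inj_on (\<lambda>k. u ((k + 1) mod ?n)) K"
  proof (rule inj_onI)
    fix k k' assume k: "k \<in> K" "k' \<in> K" "u ((k + 1) mod ?n) = u ((k' + 1) mod ?n)"
    then have "(k + 1) mod ?n = (k' + 1) mod ?n" using u_eq by simp
    then show "k = k'" using bij_betw_rotate[of ?n 1] k unfolding bij_betw_def K_def by (auto dest: inj_onD)
  qed
  then have "card ((\<lambda>k. u ((k + 1) mod ?n)) ` K) = card K" by (rule card_image)
  then have "\<exists>x\<in>(\<lambda>k. u ((k + 1) mod ?n)) ` K. balanced_set (?V - {x})"
    using cardK cardV step.hyps step.prems(2) gen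
    by (intro balanced_removable_vertex) (auto simp: K_def)
  then obtain k where k: "k \<in> K" "balanced_set (?V - {u (Suc k mod ?n)})" by auto
  have kn: "k < ?n" and ear: "{u k, u (Suc k mod ?n), u ((k + 2) mod ?n)} \<in> faces" using k(1) unfolding K_def by auto
  \<comment> \<open>The shift by k + 2 gives the tip the last index \<open>m\<close> and its
    neighbours the indices m - 1 and 0.\<close>
  define v where "v = (\<lambda>i. u ((i + (k + 2)) mod ?n))"
  note rot = rotate_polygon[OF zero_less_Suc v_def]
  have v_ends: "v (m - 1) = u k" "v m = u (Suc k mod ?n)" "v 0 = u ((k + 2) mod ?n)"
  proof -
    have "m - 1 + (k + 2) = k + ?n" "m + (k + 2) = Suc k + ?n" using step.hyps by auto
    then show "v (m - 1) = u k" "v m = u (Suc k mod ?n)" unfolding v_def using kn by (simp_all only: mod_add_self2) simp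
    show "v 0 = u ((k + 2) mod ?n)" unfolding v_def by simp
  qed
  have simple_v: "simple_polygon ?n v" using step.prems(1) rot unfolding simple_polygon_def by simp
  have "?V \<inter> open_cone3 (u k) (u (Suc k mod ?n)) (u ((k + 2) mod ?n)) = {}"
    using mod_shift_neq[of k ?n 0 1] mod_shift_neq[of k ?n 0 2] mod_shift_neq[of k ?n 1 2] kn step.hyps
    by (intro empty_if_faces[OF ear]) (auto simp: u_eq)
  then have empty: "v ` {..<?n} \<inter> open_cone3 (v (m - 1)) (v m) (v 0) = {}" unfolding v_ends rot(1) .
  note removed = remove_last_vertex[OF step.hyps(1) simple_v empty]
  have "v ` {..<m} = v ` {..<?n} - {v m}"
    using rot(3)[OF inj] by (auto simp: lessThan_Suc inj_on_def)
  then have "balanced_set (v ` {..<m})" using k(2) unfolding rot(1) v_ends by simp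
  then have "4 \<le> sign_changes m v" using step.IH removed(1) by blast
  then show ?case using removed(2) rot(4) by simp
qed

section \<open>From spherical polygons to cones\<close>

lemma generic_set_vertices:
  assumes "no_three_on_great_circle n u"
  shows "generic_set (u ` {..<n})"
  using assms unfolding no_three_on_great_circle_def generic_set_def by auto

lemma balanced_set_vertices:
  assumes "spherical_polygon n u" "balanced n u"
  shows "balanced_set (u ` {..<n})"
  unfolding balanced_set_def
proof (intro allI impI, rule ccontr)
  fix w :: "real^3" assume w: "w \<noteq> 0" "\<not> (\<exists>v\<in>u ` {..<n}. v \<bullet> w < 0)"
  have "u ` {..<n} \<subseteq> {x \<in> sphere 0 1. x \<bullet> w \<ge> 0}"
    using assms(1) w(2) unfolding spherical_polygon_def by (auto simp: not_less)
  then show False using assms(2) w(1) unfolding balanced_def closed_hemisphere_def by blast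
qed

text \<open>By generic position a crossing of two edges forces four distinct ends, hence nonadjacent
  edges. Normalising the common vector gives a common point of the two spherical segments.\<close>

lemma noncrossing_polygon_edges:
  assumes n: "4 \<le> n" and gen: "generic_set (u ` {..<n})" and simple: "no_self_intersections n u"
  shows "noncrossing (edges n u)"
  unfolding noncrossing_def
proof (intro allI impI)
  let ?V = "u ` {..<n}"
  fix a b c d assume ab: "{a, b} \<in> edges n u" and cd: "{c, d} \<in> edges n u" and ne: "{a, b} \<noteq> {c, d}"
  have inj: "inj_on u {..<n}" using simple unfolding no_self_intersections_def by simp
  have abcd: "a \<in> ?V" "b \<in> ?V" "a \<noteq> b" "c \<in> ?V" "d \<in> ?V" "c \<noteq> d"
    using edges_subset[OF inj] ab cd n by (force simp: doubleton_eq_iff)+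
  obtain i where i: "i < n" "{a, b} = {u i, u (Suc i mod n)}" using ab unfolding edges_def by blast
  obtain j where j: "j < n" "{c, d} = {u j, u (Suc j mod n)}" using cd unfolding edges_def by blast
  show "open_cone2 a b \<inter> open_cone2 c d = {}"
  proof (rule ccontr)
    assume "open_cone2 a b \<inter> open_cone2 c d \<noteq> {}"
    then obtain s where s: "s \<in> open_cone2 a b" "s \<in> open_cone2 c d" by blast
    have dist: "a \<noteq> c" "a \<noteq> d" "b \<noteq> c" "b \<noteq> d"
      using generic_crossing_disjoint[OF gen abcd(1,2,4,5,3,6) ne s] .
    then have "{u i, u (Suc i mod n)} \<inter> {u j, u (Suc j mod n)} = {}"
      unfolding i(2)[symmetric] j(2)[symmetric] by auto
    then have "i \<noteq> j" "j \<noteq> (i + 1) mod n" "i \<noteq> (j + 1) mod n" by auto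
    then have disj: "polygon_edge n u i \<inter> polygon_edge n u j = {}"
      using simple i(1) j(1) unfolding no_self_intersections_def by blast
    have s_cones: "s \<in> open_cone2 (u i) (u (Suc i mod n))" "s \<in> open_cone2 (u j) (u (Suc j mod n))"
      using s doubleton_cone_eq[OF i(2)] doubleton_cone_eq[OF j(2)] by auto
    have "s \<noteq> 0" using generic_vertex_notin_cone[OF gen abcd(4,1,2), of 0] dist abcd s by auto
    have "(1 / norm s) *\<^sub>R s \<in> great_circle_segment p q" if sc: "s \<in> open_cone2 p q" for p q
    proof -
      obtain \<alpha> \<beta> where "0 < \<alpha>" "0 < \<beta>" "s = \<alpha> *\<^sub>R p + \<beta> *\<^sub>R q" using sc by (rule open_cone2E)
      then have "(1 / norm s) *\<^sub>R s = (\<alpha> / norm s) *\<^sub>R p + (\<beta> / norm s) *\<^sub>R q" "0 \<le> \<alpha> / norm s" "0 \<le> \<beta> / norm s"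
        by (auto simp: scaleR_add_right)
      moreover have "(1 / norm s) *\<^sub>R s \<in> sphere 0 1" using \<open>s \<noteq> 0\<close> by simp
      ultimately show ?thesis unfolding great_circle_segment_def by blast
    qed
    then have "(1 / norm s) *\<^sub>R s \<in> polygon_edge n u i \<inter> polygon_edge n u j"
      using s_cones unfolding polygon_edge_def by simp
    then show False using disj by blast
  qed
qed

text \<open>Sign changes are counted by index, inflections as unordered pairs, so different indices
  must be shown to give different pairs.\<close>

lemma sign_changes_le_inflections:
  assumes n: "4 \<le> n" and inj: "inj_on u {..<n}"
  shows "sign_changes n u \<le> card (spherical_inflections n u)"
proof -
  let ?J = "{i. i < n \<and> turn n u i * turn n u (Suc i mod n) < 0}"
  let ?g = "\<lambda>i. {u (Suc i mod n), u ((i + 2) mod n)}"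
  have u_eq: "u i = u j \<longleftrightarrow> i = j" if "i < n" "j < n" for i j
    using inj_on_eq_iff[OF inj] that by auto
  have "inj_on ?g ?J"
  proof (rule inj_onI)
    fix i j assume ij: "i \<in> ?J" "j \<in> ?J" "?g i = ?g j"
    have lt: "i < n" "j < n" using ij by auto
    have "Suc i mod n = Suc j mod n \<or> Suc i mod n = (j + 2) mod n \<and> (i + 2) mod n = Suc j mod n"
      using ij(3) n by (auto simp: doubleton_eq_iff u_eq)
    then show "i = j"
    proof
      assume "Suc i mod n = Suc j mod n"
      then show "i = j" using bij_betw_rotate[of n 1] lt unfolding bij_betw_def by (auto dest: inj_onD)
    \<comment> \<open>Equal pairs in reversed order would make j + 3 and j + 1 congruent modulo
      \<open>n\<close>.\<close>
    next
      assume "Suc i mod n = (j + 2) mod n \<and> (i + 2) mod n = Suc j mod n"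
      moreover have "(i + 2) mod n = Suc (Suc i mod n) mod n" by (simp add: mod_simps)
      moreover have "Suc ((j + 2) mod n) mod n = (j + 3) mod n" by (simp add: mod_simps numeral_3_eq_3)
      ultimately show "i = j" using mod_shift_neq[of j n 3 1] lt n by simp
    qed
  qed
  moreover have "?g ` ?J \<subseteq> spherical_inflections n u"
  proof
    fix e assume "e \<in> ?g ` ?J"
    then obtain i where i: "i < n" "turn n u i * turn n u (Suc i mod n) < 0" "e = ?g i" by blast
    define k where "k = Suc i mod n"
    have k: "k < n" "(k + 1) mod n = (i + 2) mod n" "(k + n - 1) mod n = i" "(k + 2) mod n = (Suc i mod n + 2) mod n"
    proof -
      show "k < n" "(k + 1) mod n = (i + 2) mod n" "(k + 2) mod n = (Suc i mod n + 2) mod n"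
        using n unfolding k_def by (simp_all add: mod_simps)
      show "(k + n - 1) mod n = i"
      proof (cases "Suc i = n")
        case False
        then have "k = Suc i" using i(1) unfolding k_def by simp
        then show ?thesis using i(1) by simp
      qed (use i(1) n in \<open>auto simp: k_def\<close>)
    qed
    have "plane_separates (u k) (u ((k + 1) mod n)) (u ((k + n - 1) mod n)) (u ((k + 2) mod n))"
      unfolding plane_separates_iff_det3 using i(2) k by (simp add: turn_def k_def mod_simps)
    moreover have "e = {u k, u ((k + 1) mod n)}" using i(3) k(2) by (simp add: k_def)
    ultimately show "e \<in> spherical_inflections n u" unfolding spherical_inflections_def using k(1) by blast
  qed
  moreover have "finite (spherical_inflections n u)"
  proof -
    have "spherical_inflections n u \<subseteq> Pow (u ` {..<n})"
      unfolding spherical_inflections_def by auto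
    then show ?thesis by (rule finite_subset) simp
  qed
  ultimately have "card ?J \<le> card (spherical_inflections n u)" by (intro card_inj_on_le)
  then show ?thesis unfolding sign_changes_def .
qed

theorem theorem5p1:
  fixes n :: nat and u :: "nat \<Rightarrow> real^3"
  assumes "n \<ge> 4"
    and "spherical_polygon n u"
    and "no_three_on_great_circle n u"
    and "balanced n u"
    and "no_self_intersections n u"
  shows "card (spherical_inflections n u) \<ge> 4"
proof -
  have inj: "inj_on u {..<n}" using assms(5) unfolding no_self_intersections_def by simp
  have gen: "generic_set (u ` {..<n})" using assms(3) by (rule generic_set_vertices)
  have "simple_polygon n u"
    unfolding simple_polygon_def using inj gen noncrossing_polygon_edges[OF assms(1) gen assms(5)] by simp
  then have "4 \<le> sign_changes n u"
    using balanced_simple_polygon_sign_changes assms(1) balanced_set_vertices[OF assms(2,4)] by blast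
  also have "\<dots> \<le> card (spherical_inflections n u)"
    using sign_changes_le_inflections[OF _ inj] assms(1) by simp
  finally show ?thesis .
qed

end
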